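(* Let $f:\mathbb{R}^{n+m}\to\mathbb{R}$ be a $C^2$ function such that $\nabla f$ is globally Lipschitz with constant $L>0$ and $\nabla^2 f(z^\ast)$ is invertible at every saddle point $z^\ast$ of $f$. Let $\tau>0$. (i) Consider the ODE $\dot z=-\Lambda_\tau F(z)$. The set of saddle points of $f$ is a subset of the set of exponentially stable equilibria of this ODE if, for every saddle point $z^\ast$ of $f$, $\Re(\lambda)\neq0$ for all $\lambda\in\sigma(\Lambda_\tau H(z^\ast))$. (ii) Let $s>0$ and consider the ODE $\dot z=-(I+\tfrac{s}{2}\Lambda_\tau\nabla F(z))\Lambda_\tau F(z)$. The set of saddle points of $f$ is a subset of the set of exponentially stable equilibria of this ODE if, for every saddle point $z^\ast$ of $f$, $\Re(\lambda)\neq0$ for all $\lambda\in\sigma(\Lambda_\tau H(z^\ast))$ and $$s\in\Big(0,\min\Big\{\frac{\min\{1,\tau\}}{L},\ \min_{\lambda\in\sigma(\Lambda_\tau H(z^\ast))}\frac{2|\Re(\lambda)|}{\max\{L^2,\tau^{-2}L^2\}}\Big\}\Big).$$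
   Context: Write $z=(x,y)\in\mathbb{R}^n\times\mathbb{R}^m$. A (local) saddle point of $f$ is a point $(x^\ast,y^\ast)$ having a neighbourhood $U$ such that $f(x^\ast,y)\le f(x^\ast,y^\ast)\le f(x,y^\ast)$ for all $(x,y)\in U$. Notation: $F(z)=\begin{bmatrix}\nabla_x f(z)\\-\nabla_y f(z)\end{bmatrix}$, $\nabla F$ is the Jacobian matrix of $F$, $H(z)=-\nabla F(z)=\begin{bmatrix}-\nabla^2_{xx}f(z)&-\nabla^2_{xy}f(z)\\ \nabla^2_{yx}f(z)&\nabla^2_{yy}f(z)\end{bmatrix}$, $\Lambda_\tau=\begin{bmatrix}\frac1\tau I&0\\0&I\end{bmatrix}$ (blocks of sizes $n$ and $m$); $\sigma(\cdot)$ is the spectrum. An equilibrium $Z^e$ of an ODE is exponentially stable (meant locally) if it is stable (for every $\varepsilon>0$ there is $\delta>0$ such that $|Z(0)-Z^e|<\delta$ implies $|Z(t)-Z^e|<\varepsilon$ for all $t\ge0$) and there exist $\delta,M,\lambda>0$ such that $|Z(0)-Z^e|<\delta$ implies $|Z(t)-Z^e|\le Me^{-\lambda t}|Z(0)-Z^e|$ for all $t\ge0$. (The ODEs in (i) and (ii) are the $O(1)$- and $O(s)$-resolution ODEs of the Two-Timescale Gradient Descent Ascent iteration $z_{k+1}=z_k-s\Lambda_\tau F(z_k)$.) *)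

theory Defs
  imports "HOL-Analysis.Analysis"
begin

text \<open>
  A point \<open>z = (x, y)\<close> of \<open>\<real>\<^sup>n \<times> \<real>\<^sup>m = \<real>\<^sup>n\<^sup>+\<^sup>m\<close> is a vector indexed by the sum type \<open>'n + 'm\<close>:
  the coordinates \<open>Inl i\<close> form \<open>x\<close> and the coordinates \<open>Inr j\<close> form \<open>y\<close>. Thus \<open>(n+m) \<times> (n+m)\<close>
  matrices are ordinary matrices, with the blocks given by \<open>Inl\<close> and \<open>Inr\<close>.
\<close>

definition join :: "real^'n \<Rightarrow> real^'m \<Rightarrow> real^('n::finite + 'm::finite)" where
  "join x y = (\<chi> k. case k of Inl i \<Rightarrow> x $ i | Inr j \<Rightarrow> y $ j)"

definition saddle_points :: "(real^('n::finite + 'm::finite) \<Rightarrow> real) \<Rightarrow> (real^('n + 'm)) set" where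
  "saddle_points f = {z. \<exists>xs ys. z = join xs ys \<and>
     (\<exists>U. open U \<and> join xs ys \<in> U \<and>
        (\<forall>x y. join x y \<in> U \<longrightarrow> f (join xs y) \<le> f (join xs ys) \<and> f (join xs ys) \<le> f (join x ys)))}"

definition grad :: "(real^'k::finite \<Rightarrow> real) \<Rightarrow> real^'k \<Rightarrow> real^'k" where
  "grad f z = (\<chi> k. frechet_derivative f (at z) (axis k 1))"

definition hessian :: "(real^'k::finite \<Rightarrow> real) \<Rightarrow> real^'k \<Rightarrow> real^'k^'k" where
  "hessian f z = jacobian (grad f) (at z)"

text \<open>
  The class \<open>C\<^sup>2\<close> on the whole space. Both differentiability conditions are needed:
  \<^const>\<open>frechet_derivative\<close> is an arbitrary choice where the derivative does not exist.
\<close>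

definition C2 :: "(real^'k::finite \<Rightarrow> real) \<Rightarrow> bool" where
  "C2 f \<longleftrightarrow> (\<forall>z. f differentiable (at z)) \<and> (\<forall>z. grad f differentiable (at z)) \<and>
            continuous_on UNIV (hessian f)"

definition saddle_field ::
    "(real^('n::finite + 'm::finite) \<Rightarrow> real) \<Rightarrow> real^('n + 'm) \<Rightarrow> real^('n + 'm)" where
  "saddle_field f z = (\<chi> k. case k of Inl i \<Rightarrow> grad f z $ Inl i | Inr j \<Rightarrow> - (grad f z $ Inr j))"

definition H_matrix ::
    "(real^('n::finite + 'm::finite) \<Rightarrow> real) \<Rightarrow> real^('n + 'm) \<Rightarrow> real^('n + 'm)^('n + 'm)" where
  "H_matrix f z = - jacobian (saddle_field f) (at z)"

definition Lambda_matrix :: "real \<Rightarrow> real^('n::finite + 'm::finite)^('n + 'm)" where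
  "Lambda_matrix \<tau> =
     (\<chi> k l. if k = l then (case k of Inl i \<Rightarrow> 1 / \<tau> | Inr j \<Rightarrow> 1) else 0)"

text \<open>
  The spectrum of a real matrix consists of its complex eigenvalues; it is finite and nonempty,
  so a minimum over it is a genuine \<^const>\<open>Min\<close>.
\<close>

definition spectrum :: "real^'k::finite^'k \<Rightarrow> complex set" where
  "spectrum A = {\<mu>. \<exists>v. v \<noteq> 0 \<and> map_matrix complex_of_real A *v v = \<mu> *s v}"

definition solution_on ::
    "('a::real_normed_vector \<Rightarrow> 'a) \<Rightarrow> real \<Rightarrow> (real \<Rightarrow> 'a) \<Rightarrow> bool" where
  "solution_on g T Z \<longleftrightarrow>
     (\<forall>t\<in>{0..T}. (Z has_vector_derivative g (Z t)) (at t within {0..T}))"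

text \<open>
  The estimates below are required along every solution on every compact interval \<open>[0, T]\<close>.
  This contains the estimates for all \<open>t \<ge> 0\<close> along every solution on \<open>[0, \<infinity>)\<close> (restrict it to
  \<open>[0, T]\<close>) and also covers solutions not known to be global; demanding the estimates of global
  solutions only would make an equilibrium vacuously stable when all nearby solutions blow up.
\<close>

definition stable_at :: "('a::real_normed_vector \<Rightarrow> 'a) \<Rightarrow> 'a \<Rightarrow> bool" where
  "stable_at g Ze \<longleftrightarrow> (\<forall>\<epsilon>>0. \<exists>\<delta>>0. \<forall>T>0. \<forall>Z. solution_on g T Z \<longrightarrow> norm (Z 0 - Ze) < \<delta> \<longrightarrow>
      (\<forall>t\<in>{0..T}. norm (Z t - Ze) < \<epsilon>))"

definition exponentially_attracting_at :: "('a::real_normed_vector \<Rightarrow> 'a) \<Rightarrow> 'a \<Rightarrow> bool" where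
  "exponentially_attracting_at g Ze \<longleftrightarrow>
     (\<exists>\<delta>>0. \<exists>M>0. \<exists>r>0. \<forall>T>0. \<forall>Z. solution_on g T Z \<longrightarrow> norm (Z 0 - Ze) < \<delta> \<longrightarrow>
        (\<forall>t\<in>{0..T}. norm (Z t - Ze) \<le> M * exp (- r * t) * norm (Z 0 - Ze)))"

definition exp_stable_equilibria :: "('a::real_normed_vector \<Rightarrow> 'a) \<Rightarrow> 'a set" where
  "exp_stable_equilibria g =
     {Ze. g Ze = 0 \<and> stable_at g Ze \<and> exponentially_attracting_at g Ze}"

definition ode_O1 ::
    "(real^('n::finite + 'm::finite) \<Rightarrow> real) \<Rightarrow> real \<Rightarrow> real^('n + 'm) \<Rightarrow> real^('n + 'm)" where
  "ode_O1 f \<tau> z = - (Lambda_matrix \<tau> *v saddle_field f z)"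

definition ode_Os ::
    "(real^('n::finite + 'm::finite) \<Rightarrow> real) \<Rightarrow> real \<Rightarrow> real \<Rightarrow> real^('n + 'm) \<Rightarrow> real^('n + 'm)" where
  "ode_Os f \<tau> s z =
     - ((mat 1 + (s / 2) *\<^sub>R (Lambda_matrix \<tau> ** jacobian (saddle_field f) (at z)))
          *v (Lambda_matrix \<tau> *v saddle_field f z))"

end

theory Submission
  imports Defs "HOL-Computational_Algebra.Fundamental_Theorem_Algebra"
begin

text \<open>
  At a saddle point the gradient vanishes and, the Hessian being symmetric with
  \<open>\<nabla>\<^sup>2\<^sub>x\<^sub>x f \<ge> 0\<close> and \<open>\<nabla>\<^sup>2\<^sub>y\<^sub>y f \<le> 0\<close>, the mixed blocks cancel in the quadratic form of \<open>H\<close>, so it is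
  negative semidefinite. In the inner product weighted by \<open>\<Lambda>\<^sub>\<tau>\<close> inverse this gives \<open>Re \<mu> \<le> 0\<close> for
  every eigenvalue \<open>\<mu>\<close> of \<open>K = \<Lambda>\<^sub>\<tau> H\<close>, hence \<open>Re \<mu> < 0\<close> by hypothesis. The two ODEs linearize to \<open>K\<close>
  and \<open>K - (s/2) K\<^sup>2\<close>. The eigenvalues of the latter are \<open>\<mu> - (s/2) \<mu>\<^sup>2\<close>, with negative real part
  because \<open>s |\<mu>|\<^sup>2 < 2 |Re \<mu>|\<close>.

  Stability from the linearization needs a quadratic Lyapunov form for a matrix \<open>A\<close> whose eigenvalues
  have negative real parts. Some nonzero polynomial annihilates \<open>A\<close>; splitting off one root \<open>\<mu>\<close> at
  a time, a form \<open>B\<close> that works where the remaining factor vanishes is improved to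
  \<open>c B((A - \<mu>)u, (A - \<mu>)v) + \<langle>u, v\<rangle>\<close> with \<open>c\<close> large, and roots that are not eigenvalues are discarded.
\<close>

subsection \<open>Quadratic Lyapunov forms\<close>

text \<open>This is p(M) v, written with iterates of multiplication by M so that its algebra follows
  from linearity of that map.\<close>

definition poly_action :: "complex^'k::finite^'k \<Rightarrow> complex poly \<Rightarrow> complex^'k \<Rightarrow> complex^'k" where
  "poly_action M p v = (\<Sum>i\<le>degree p. coeff p i *s (((*v) M ^^ i) v))"

lemma poly_action_altdef:
  assumes "degree p \<le> N"
  shows "poly_action M p v = (\<Sum>i\<le>N. coeff p i *s (((*v) M ^^ i) v))"
  unfolding poly_action_def
  by (rule sum.mono_neutral_left) (use assms in \<open>auto simp: coeff_eq_0\<close>)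

lemma matrix_pow_diff: "((*v) (M::complex^'k::finite^'k) ^^ i) (v - w) = ((*v) M ^^ i) v - ((*v) M ^^ i) w"
  by (induction i) (simp_all add: matrix_vector_mult_diff_distrib)

lemma matrix_pow_smult: "((*v) (M::complex^'k::finite^'k) ^^ i) (c *s v) = c *s ((*v) M ^^ i) v"
  by (induction i) (simp_all add: vec.scale)

text \<open>Coefficient i of (X - \<mu>) q is q_(i-1) - \<mu> q_i, and shifting the index in the
  first part makes q act on M v. In this way a root is peeled off a polynomial by moving it into the
  vector.\<close>

lemma poly_action_factor:
  "poly_action M ([:-\<mu>, 1:] * q) v = poly_action M q (M *v v - \<mu> *s v)"
proof -
  let ?N = "degree q" and ?P = "\<lambda>i. ((*v) M ^^ i)"
  have deg: "degree ([:-\<mu>, 1:] * q) \<le> Suc ?N"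
    using degree_mult_le[of "[:-\<mu>, 1:]" q] by simp
  have "poly_action M ([:-\<mu>, 1:] * q) v
      = (\<Sum>i\<le>Suc ?N. (- \<mu> * coeff q i) *s ?P i v + (case i of 0 \<Rightarrow> 0 | Suc j \<Rightarrow> coeff q j) *s ?P i v)"
    unfolding poly_action_altdef[OF deg]
    by (rule sum.cong) (auto simp: vec.scale_left_distrib[symmetric] coeff_pCons split: nat.splits)
  also have "\<dots> = (\<Sum>i\<le>Suc ?N. (- \<mu> * coeff q i) *s ?P i v) + (\<Sum>i\<le>?N. coeff q i *s ?P (Suc i) v)"
    by (simp add: sum.distrib sum_subtractf sum_negf sum.atMost_Suc_shift del: sum.atMost_Suc funpow.simps)
  also have "(\<Sum>i\<le>Suc ?N. (- \<mu> * coeff q i) *s ?P i v) = (\<Sum>i\<le>?N. (- \<mu> * coeff q i) *s ?P i v)"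
    by (simp add: coeff_eq_0)
  finally show ?thesis
    unfolding poly_action_def matrix_pow_diff matrix_pow_smult
    by (simp add: sum.distrib[symmetric] funpow_swap1 vector_ssub_ldistrib vector_smult_assoc
        mult.commute algebra_simps vec.scale_minus_left cong: sum.cong)
qed

lemma poly_action_commute:
  "poly_action M q (M *v v - \<mu> *s v) = M *v poly_action M q v - \<mu> *s poly_action M q v"
  unfolding poly_action_def matrix_pow_diff matrix_pow_smult
  by (simp add: vec.linear_sum vec.sum vec.scale vec.scale_sum_right sum_subtractf[symmetric]
      vector_ssub_ldistrib vector_smult_assoc mult.commute funpow_swap1)

lemma poly_action_eigenvector:
  assumes "M *v v = \<mu> *s v"
  shows "poly_action M p v = poly p \<mu> *s v"
proof -
  have "((*v) M ^^ i) v = \<mu> ^ i *s v" for i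
    by (induction i) (simp_all add: vec.scale assms vector_smult_assoc mult.commute)
  then show ?thesis
    by (simp add: poly_action_def poly_altdef vec.scale_sum_left vector_smult_assoc)
qed

lemma linear_complex_matrix: "linear ((*v) (M::complex^'k::finite^'k))"
  by (rule linearI)
    (simp_all add: vec_eq_iff matrix_vector_mult_def scaleR_sum_right sum.distrib distrib_left)

lemma inner_smult_self: "(v::complex^'k::finite) \<bullet> (c *s v) = Re c * (v \<bullet> v)"
  by (simp add: inner_vec_def sum_distrib_left inner_complex_def algebra_simps)

text \<open>Young's inequality, from the square of \<rho> v - w; it absorbs the cross term that
  arises when a Lyapunov form is extended by one root.\<close>

lemma inner_le_weighted:
  fixes v w :: "'a::real_inner"
  assumes "\<rho> > 0"
  shows "v \<bullet> w \<le> \<rho> / 2 * (v \<bullet> v) + 1 / (2 * \<rho>) * (w \<bullet> w)"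
proof -
  have "0 \<le> (\<rho> *\<^sub>R v - w) \<bullet> (\<rho> *\<^sub>R v - w)"
    by simp
  then have "2 * \<rho> * (v \<bullet> w) \<le> \<rho>\<^sup>2 * (v \<bullet> v) + w \<bullet> w"
    by (simp add: inner_diff inner_commute power2_eq_square algebra_simps)
  then show ?thesis
    using assms by (simp add: field_simps power2_eq_square)
qed

text \<open>Positivity is asked everywhere but decay only on the kernel of p(M); this relative form
  makes induction on the degree possible. \<open>B\<close> is bilinear over the reals and
  \<open>\<bullet>\<close> is the real inner product of complex vectors, so that the inner product
  of v with \<mu> v is Re \<mu> |v|^2. For a nonzero constant p the kernel is trivial.\<close>

lemma lyapunov_form_poly:
  fixes M :: "complex^'k::finite^'k"
  assumes "\<And>\<mu> v. v \<noteq> 0 \<Longrightarrow> M *v v = \<mu> *s v \<Longrightarrow> Re \<mu> < 0"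
  shows "p \<noteq> 0 \<Longrightarrow> \<exists>B r. bilinear B \<and> (\<forall>u v. B u v = B v u) \<and> (\<forall>v. v \<bullet> v \<le> B v v) \<and> 0 < r \<and>
           (\<forall>v. poly_action M p v = 0 \<longrightarrow> B v (M *v v) \<le> - r * B v v)"
proof (induction "degree p" arbitrary: p)
  case 0
  then obtain c where "p = [:c:]" "c \<noteq> 0"
    by (metis degree_eq_zeroE pCons_eq_0_iff)
  then have *: "poly_action M p v = 0 \<longleftrightarrow> v = 0" for v
    by (simp add: poly_action_def)
  have "bilinear ((\<bullet>) :: complex^'k \<Rightarrow> _)"
    by (simp add: bilinear_conv_bounded_bilinear bounded_bilinear_inner)
  then show ?case
    by (intro exI[of _ "(\<bullet>)"] exI[of _ 1]) (simp add: inner_commute *)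
next
  case (Suc n)
  then have "\<not> constant (poly p)"
    by (simp add: constant_degree)
  then obtain \<mu> where "poly p \<mu> = 0"
    using fundamental_theorem_of_algebra by blast
  then obtain q where p: "p = [:-\<mu>, 1:] * q"
    by (metis dvdE poly_eq_0_iff_dvd)
  have "q \<noteq> 0"
    using Suc.prems p by auto
  moreover have "n = degree q"
    using Suc.hyps(2) \<open>q \<noteq> 0\<close> unfolding p by (subst (asm) degree_mult_eq) auto
  ultimately obtain B r where B: "bilinear B" "\<And>u v. B u v = B v u" "\<And>v. v \<bullet> v \<le> B v v" "0 < r"
      "\<And>v. poly_action M q v = 0 \<Longrightarrow> B v (M *v v) \<le> - r * B v v"
    using Suc.hyps(1)[of q] by blast
  show ?case
  proof (cases "\<exists>v. v \<noteq> 0 \<and> M *v v = \<mu> *s v")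
    case False
    \<comment> \<open>M - \<mu> is injective and commutes with q(M), so p(M) and q(M) have the same
      kernel and the old form serves.\<close>
    have "poly_action M q v = 0" if "poly_action M p v = 0" for v
      using that False unfolding p poly_action_factor poly_action_commute by auto
    then show ?thesis
      using B by blast
  next
    case True
    define \<rho> where "\<rho> = - Re \<mu>"
    have \<rho>: "\<rho> > 0"
      using True assms unfolding \<rho>_def by force
    \<comment> \<open>With this K, Young's inequality at weight \<rho> bounds the product of v and D
      v by \<rho>/2 |v|^2 plus half of the decay K r B(D v, D v). Half of each decay rate survives,
      whence the minimum of r/2 and \<rho>/2 below.\<close>
    define K where "K = 1 / (r * \<rho>)"
    have K: "K > 0" "K * r / 2 = 1 / (2 * \<rho>)"
      using \<rho> B(4) by (auto simp: K_def)
    define D where "D v = M *v v - \<mu> *s v" for v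
    define B' where "B' u v = K * B (D u) (D v) + u \<bullet> v" for u v
    have linD: "linear D"
      by (rule linearI) (auto simp: D_def linear_add[OF linear_complex_matrix]
          linear_scale[OF linear_complex_matrix] vec_eq_iff algebra_simps)
    have bil: "bilinear B'"
      unfolding bilinear_def
      by (auto intro!: linearI simp: B'_def linear_add[OF linD] linear_scale[OF linD] bilinear_ladd[OF B(1)]
        bilinear_radd[OF B(1)] bilinear_lmul[OF B(1)] bilinear_rmul[OF B(1)] inner_add algebra_simps)
    have MD: "D (M *v v) = M *v D v" for v
      by (simp add: D_def matrix_vector_mult_diff_distrib vec.scale)
    have Bpos: "0 \<le> B v v" for v
      using B(3)[of v] inner_ge_zero[of v] by linarith
    have "B' v (M *v v) \<le> - min (r / 2) (\<rho> / 2) * B' v v" if "poly_action M p v = 0" for v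
    proof -
      \<comment> \<open>D v lies in the kernel of q(M), where the induction hypothesis gives decay,
        and D commutes with M.\<close>
      have "poly_action M q (D v) = 0"
        using that unfolding D_def p poly_action_factor .
      then have 1: "K * B (D v) (M *v D v) \<le> K * (- r * B (D v) (D v))"
        using B(5) K by (intro mult_left_mono) auto
      have "M *v v = \<mu> *s v + D v"
        by (simp add: D_def)
      then have 2: "v \<bullet> (M *v v) = - \<rho> * (v \<bullet> v) + v \<bullet> D v"
        by (simp add: inner_add_right inner_smult_self \<rho>_def)
      have "1 / (2 * \<rho>) * (D v \<bullet> D v) \<le> 1 / (2 * \<rho>) * B (D v) (D v)"
        using \<rho> B(3) by (intro mult_left_mono) auto
      then have 3: "v \<bullet> D v \<le> \<rho> / 2 * (v \<bullet> v) + K * r / 2 * B (D v) (D v)"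
        using inner_le_weighted[OF \<rho>, of v "D v"] unfolding K by linarith
      have 4: "min (r / 2) (\<rho> / 2) * (K * B (D v) (D v)) \<le> r / 2 * (K * B (D v) (D v))"
        using K Bpos by (intro mult_right_mono) auto
      have 5: "min (r / 2) (\<rho> / 2) * (v \<bullet> v) \<le> \<rho> / 2 * (v \<bullet> v)"
        by (intro mult_right_mono) auto
      show ?thesis
        unfolding B'_def MD using 1 2 3 4 5 by (simp add: algebra_simps)
    qed
    moreover have "v \<bullet> v \<le> B' v v" for v
      using K Bpos by (simp add: B'_def)
    moreover have "B' u v = B' v u" for u v
      by (simp add: B'_def B(2) inner_commute)
    moreover have "min (r / 2) (\<rho> / 2) > 0"
      using \<rho> B(4) by simp
    ultimately show ?thesis
      using bil by blast
  qed
qed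

text \<open>Among DIM + 1 vectors either two coincide, which gives coefficients 1 and -1, or all are
  distinct and the dimension forces a relation. The cases are separate because
  \<open>dependent\<close> speaks of a set and loses repetitions.\<close>

lemma nontrivial_relation:
  fixes g :: "nat \<Rightarrow> 'a::euclidean_space"
  obtains c N where "\<exists>i\<le>N. c i \<noteq> 0" "(\<Sum>i\<le>N. c i *\<^sub>R g i) = 0"
proof (cases "inj_on g {..DIM('a)}")
  case True
  then have "card (g ` {..DIM('a)}) = Suc (DIM('a))"
    by (simp add: card_image)
  then have "dependent (g ` {..DIM('a)})"
    using independent_bound by fastforce
  then obtain u where "\<exists>v\<in>g ` {..DIM('a)}. u v \<noteq> 0" "(\<Sum>v\<in>g ` {..DIM('a)}. u v *\<^sub>R v) = 0"
    by (auto simp: dependent_finite)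
  then show ?thesis
    using that[of "DIM('a)" "u \<circ> g"] by (auto simp: sum.reindex[OF True])
next
  case False
  then obtain i j where ij: "i \<le> DIM('a)" "j \<le> DIM('a)" "i \<noteq> j" "g i = g j"
    by (auto simp: inj_on_def)
  define c where "c k = (if k = i then 1 else if k = j then -1 else 0 :: real)" for k
  have "(\<Sum>k\<le>DIM('a). c k *\<^sub>R g k) = (\<Sum>k\<in>{i,j}. c k *\<^sub>R g k)"
    by (rule sum.mono_neutral_right) (use ij in \<open>auto simp: c_def\<close>)
  also have "\<dots> = 0"
    using ij by (simp add: c_def)
  finally show ?thesis
    using that[of "DIM('a)" c] ij(1) by (metis c_def zero_neq_one)
qed

text \<open>The powers of M lie in a real vector space of finite dimension; the coefficients of a
  linear relation between them form p.\<close>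

lemma annihilating_poly:
  fixes M :: "complex^'k::finite^'k"
  obtains p where "p \<noteq> 0" "\<And>v. poly_action M p v = 0"
proof -
  define P where "P i = ((**) M ^^ i) (mat 1)" for i
  have P: "P i *v v = ((*v) M ^^ i) v" for i v
    by (induction i) (simp_all add: P_def matrix_vector_mul_assoc[symmetric])
  obtain c N where c: "\<exists>i\<le>N. c i \<noteq> 0" "(\<Sum>i\<le>N. c i *\<^sub>R P i) = 0"
    by (rule nontrivial_relation[of P])
  define p where "p = (\<Sum>i\<le>N. monom (complex_of_real (c i)) i)"
  have coeff: "coeff p i = (if i \<le> N then complex_of_real (c i) else 0)" for i
    by (simp add: p_def coeff_sum)
  have "p \<noteq> 0"
    using c(1) coeff by (metis coeff_0 of_real_eq_0_iff)
  moreover have "poly_action M p v = 0" for v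
  proof -
    have "degree p \<le> N"
      by (rule degree_le) (simp add: coeff)
    then have "poly_action M p v = (\<Sum>i\<le>N. complex_of_real (c i) *s (P i *v v))"
      by (simp add: poly_action_altdef P coeff)
    also have "\<dots> = (\<Sum>i\<le>N. (c i *\<^sub>R P i) *v v)"
      by (intro sum.cong refl) (simp add: vec_eq_iff matrix_vector_mult_def sum_distrib_left scaleR_conv_of_real[where 'a=complex] mult.assoc)
    also have "\<dots> = (\<Sum>i\<le>N. c i *\<^sub>R P i) *v v"
      by (induction N) (simp_all add: matrix_vector_mult_add_rdistrib)
    finally show ?thesis
      using c(2) by simp
  qed
  ultimately show ?thesis
    using that by blast
qed

text \<open>An annihilating polynomial vanishes at every eigenvalue. Finiteness makes the minimum in
  the step-size condition a lower bound of its terms.\<close>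

lemma finite_spectrum: "finite (spectrum A)"
proof -
  obtain p where p: "p \<noteq> 0" "\<And>v. poly_action (map_matrix complex_of_real A) p v = 0"
    by (rule annihilating_poly) blast
  have "spectrum A \<subseteq> {\<mu>. poly p \<mu> = 0}"
    using p(2) by (auto simp: spectrum_def dest: poly_action_eigenvector[where p = p])
  then show ?thesis
    using p(1) poly_roots_finite finite_subset by blast
qed

section \<open>From complex forms back to real matrices\<close>

definition cvec :: "real^'k::finite \<Rightarrow> complex^'k" where
  "cvec x = (\<chi> i. complex_of_real (x $ i))"

lemma linear_cvec: "linear cvec"
  by (rule linearI) (simp_all add: cvec_def vec_eq_iff scaleR_conv_of_real[where 'a=complex])

lemma cvec_inner: "cvec x \<bullet> cvec y = x \<bullet> y"
  by (simp add: cvec_def inner_vec_def inner_complex_def)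

lemma cvec_matrix: "map_matrix complex_of_real A *v cvec x = cvec (A *v x)"
  by (simp add: cvec_def matrix_vector_mult_def vec_eq_iff)

text \<open>Complexify, take p with p(M) = 0 so that the decay holds on the whole space, and
  restrict the form to real vectors, where \<open>cvec\<close> preserves the inner product.\<close>

lemma lyapunov_form:
  fixes A :: "real^'k::finite^'k"
  assumes "\<And>\<mu>. \<mu> \<in> spectrum A \<Longrightarrow> Re \<mu> < 0"
  obtains B r where "bilinear B" "\<And>u v. B u v = B v u" "\<And>v. v \<bullet> v \<le> B v v" "0 < r"
    "\<And>v. B v (A *v v) \<le> - r * B v v"
proof -
  let ?M = "map_matrix complex_of_real A"
  obtain p where p: "p \<noteq> 0" "\<And>v. poly_action ?M p v = 0"
    by (rule annihilating_poly) blast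
  have "\<exists>B r. bilinear B \<and> (\<forall>u v. B u v = B v u) \<and> (\<forall>v. v \<bullet> v \<le> B v v) \<and> 0 < r \<and>
           (\<forall>v. poly_action ?M p v = 0 \<longrightarrow> B v (?M *v v) \<le> - r * B v v)"
    by (rule lyapunov_form_poly) (use assms p in \<open>auto simp: spectrum_def\<close>)
  then obtain B r where B: "bilinear B" "\<And>u v. B u v = B v u" "\<And>v. v \<bullet> v \<le> B v v" "0 < r"
      "\<And>v. B v (?M *v v) \<le> - r * B v v"
    using p(2) by blast
  have "bilinear (\<lambda>x y. B (cvec x) (cvec y))"
    unfolding bilinear_def
    by (auto intro!: linearI simp: linear_add[OF linear_cvec] linear_scale[OF linear_cvec]
        bilinear_ladd[OF B(1)] bilinear_radd[OF B(1)] bilinear_lmul[OF B(1)] bilinear_rmul[OF B(1)])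
  moreover have "x \<bullet> x \<le> B (cvec x) (cvec x)" for x
    using B(3)[of "cvec x"] by (simp add: cvec_inner)
  moreover have "B (cvec x) (cvec (A *v x)) \<le> - r * B (cvec x) (cvec x)" for x
    using B(5)[of "cvec x"] by (simp add: cvec_matrix)
  ultimately show ?thesis
    using that[of "\<lambda>x y. B (cvec x) (cvec y)" r] B(2,4) by blast
qed

subsection \<open>Stability from the linearization\<close>

text \<open>Decay is known only below the level m, so V must first be confined there. At a first
  time b with V b >= m, the decay on (0, b) already gives V b <= V 0 < m, a contradiction.\<close>

lemma lyapunov_decay:
  fixes V V' :: "real \<Rightarrow> real"
  assumes der: "\<And>t. t \<in> {0..T} \<Longrightarrow> (V has_real_derivative V' t) (at t within {0..T})"
    and decay: "\<And>t. t \<in> {0..T} \<Longrightarrow> V t < m \<Longrightarrow> V' t \<le> - \<kappa> * V t"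
    and nonneg: "\<And>t. t \<in> {0..T} \<Longrightarrow> 0 \<le> V t"
    and "\<kappa> \<ge> 0" and init: "V 0 < m" and t: "t \<in> {0..T}"
  shows "V t \<le> exp (- \<kappa> * t) * V 0"
proof -
  have cont: "continuous_on {0..T} V"
    using der by (meson DERIV_continuous_on)
  \<comment> \<open>The level is respected only strictly before b, so that this applies to the first
    exit time itself. On (0, b) the function exp(\<kappa> x) V x has nonpositive derivative.\<close>
  have decay_upto: "V b \<le> exp (- \<kappa> * b) * V 0"
    if b: "b \<in> {0..T}" and below: "\<And>x. 0 < x \<Longrightarrow> x < b \<Longrightarrow> V x < m" for b
  proof -
    have "exp (\<kappa> * b) * V b \<le> exp (\<kappa> * 0) * V 0"
    proof (rule DERIV_nonpos_imp_decreasing_open[where f = "\<lambda>x. exp (\<kappa> * x) * V x"])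
      show "0 \<le> b"
        using b by simp
      show "continuous_on {0..b} (\<lambda>x. exp (\<kappa> * x) * V x)"
        by (intro continuous_intros continuous_on_subset[OF cont]) (use b in auto)
      fix x assume x: "0 < x" "x < b"
      then have "(V has_real_derivative V' x) (at x)"
        using der[of x] b by (simp add: at_within_Icc_at)
      then have "((\<lambda>x. exp (\<kappa> * x) * V x) has_real_derivative exp (\<kappa> * x) * (V' x + \<kappa> * V x)) (at x)"
        by (auto intro!: derivative_eq_intros simp: algebra_simps)
      moreover have "exp (\<kappa> * x) * (V' x + \<kappa> * V x) \<le> 0"
        using decay[of x] below[OF x] x b by (intro mult_nonneg_nonpos) auto
      ultimately show "\<exists>y. ((\<lambda>x. exp (\<kappa> * x) * V x) has_real_derivative y) (at x) \<and> y \<le> 0"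
        by blast
    qed
    then show ?thesis
      by (simp add: exp_minus field_simps)
  qed
  have "V x < m" if x: "x \<in> {0..T}" for x
  proof (rule ccontr)
    assume "\<not> V x < m"
    define S where "S = {0..T} \<inter> V -` {m..}"
    have "S \<noteq> {}"
      using x \<open>\<not> V x < m\<close> by (auto simp: S_def)
    moreover have "compact S"
      using continuous_closed_preimage[OF cont, of "{m..}"] bounded_subset[of "{0..T}" S]
      by (simp add: S_def compact_eq_bounded_closed)
    \<comment> \<open>The first exit time, attained because S is closed and bounded.\<close>
    ultimately obtain b where b: "b \<in> S" "\<And>y. y \<in> S \<Longrightarrow> b \<le> y"
      using compact_attains_inf[of S] by auto
    have "V b \<le> exp (- \<kappa> * b) * V 0"
    proof (rule decay_upto)
      show "b \<in> {0..T}"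
        using b(1) by (simp add: S_def)
      show "V x < m" if "0 < x" "x < b" for x
        using b(2)[of x] that \<open>b \<in> {0..T}\<close> by (force simp: S_def)
    qed
    also have "\<dots> \<le> 1 * V 0"
      using b(1) \<open>\<kappa> \<ge> 0\<close> nonneg[of 0] by (intro mult_right_mono) (auto simp: S_def)
    finally show False
      using init b(1) by (auto simp: S_def)
  qed
  then show ?thesis
    using t by (intro decay_upto) auto
qed

text \<open>As exp(-r t) <= 1, the attraction estimate is a bound M |Z 0 - z| uniform in t, so the
  radius \<epsilon> / M works once capped by the radius of attraction.\<close>

lemma exponentially_attracting_imp_stable:
  assumes "exponentially_attracting_at g z"
  shows "stable_at g z"
  unfolding stable_at_def
proof (intro allI impI)
  obtain \<delta> M r where h: "\<delta> > 0" "M > 0" "r > 0"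
    "\<forall>T>0. \<forall>Z. solution_on g T Z \<longrightarrow> norm (Z 0 - z) < \<delta> \<longrightarrow>
       (\<forall>t\<in>{0..T}. norm (Z t - z) \<le> M * exp (- r * t) * norm (Z 0 - z))"
    using assms unfolding exponentially_attracting_at_def by blast
  fix \<epsilon> :: real
  assume "\<epsilon> > 0"
  have "norm (Z t - z) < \<epsilon>"
    if Z: "T > 0" "solution_on g T Z" "norm (Z 0 - z) < min \<delta> (\<epsilon> / M)" "t \<in> {0..T}" for T Z t
  proof -
    have "norm (Z t - z) \<le> M * exp (- r * t) * norm (Z 0 - z)"
      using h Z by simp
    also have "\<dots> \<le> M * 1 * norm (Z 0 - z)"
      using h Z by (intro mult_right_mono mult_left_mono) auto
    also have "\<dots> < \<epsilon>"
      using Z(3) h(2) by (simp add: field_simps)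
    finally show ?thesis .
  qed
  then show "\<exists>\<delta>>0. \<forall>T>0. \<forall>Z. solution_on g T Z \<longrightarrow> norm (Z 0 - z) < \<delta> \<longrightarrow>
      (\<forall>t\<in>{0..T}. norm (Z t - z) < \<epsilon>)"
    using h \<open>\<epsilon> > 0\<close> by (intro exI[of _ "min \<delta> (\<epsilon> / M)"]) auto
qed

text \<open>Lyapunov's indirect method: a form that decays under the linear part still decays near z
  at half that rate, since the remainder is o(|w|). The factor 2 from differentiating
  \<open>B w w\<close> makes V decay at rate r.\<close>

lemma linearization_exp_stable:
  fixes g :: "real^'k::finite \<Rightarrow> real^'k"
  assumes g: "g z = 0" and der: "(g has_derivative (*v) A) (at z)"
    and spec: "\<And>\<mu>. \<mu> \<in> spectrum A \<Longrightarrow> Re \<mu> < 0"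
  shows "z \<in> exp_stable_equilibria g"
proof -
  obtain B r where B: "bilinear B" "\<And>u v. B u v = B v u" "\<And>v. v \<bullet> v \<le> B v v" "0 < r"
    "\<And>v. B v (A *v v) \<le> - r * B v v"
    using lyapunov_form[OF spec] by blast
  interpret bounded_bilinear B
    using B(1) by (simp add: bilinear_conv_bounded_bilinear)
  obtain C where C: "C > 0" "\<And>u v. norm (B u v) \<le> norm u * norm v * C"
    using pos_bounded by blast
  have normB: "(norm v)\<^sup>2 \<le> B v v" for v
    using B(3)[of v] by (simp add: power2_norm_eq_inner)
  \<comment> \<open>As C bounds B, the tolerance r / (2 C) makes the remainder contribute at most
    r/2 |w|^2, hence at most half of r \<open>B w w\<close>.\<close>
  obtain \<eta> where \<eta>: "\<eta> > 0" "\<And>y. norm (y - z) < \<eta> \<Longrightarrow>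
      norm (g y - A *v (y - z)) \<le> r / (2 * C) * norm (y - z)"
  proof -
    have "r / (2 * C) > 0"
      using B(4) C(1) by simp
    with der show ?thesis
      using that unfolding has_derivative_at_alt g by fastforce
  qed
  have field: "2 * B w (g (z + w)) \<le> - r * B w w" if "norm w < \<eta>" for w
  proof -
    define R where "R = g (z + w) - A *v w"
    have "B w R \<le> norm w * norm R * C"
      using C(2)[of w R] by simp
    also have "\<dots> \<le> norm w * (r / (2 * C) * norm w) * C"
      using \<eta>(2)[of "z + w"] that C(1) by (intro mult_right_mono mult_left_mono) (auto simp: R_def)
    also have "\<dots> = r / 2 * (norm w)\<^sup>2"
      using C(1) by (simp add: power2_eq_square)
    also have "\<dots> \<le> r / 2 * B w w"
      using B(4) normB by (intro mult_left_mono) auto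
    finally have "B w (A *v w) + B w R \<le> - r * B w w + r / 2 * B w w"
      using B(5)[of w] by linarith
    moreover have "g (z + w) = A *v w + R"
      by (simp add: R_def)
    ultimately show ?thesis
      by (simp add: add_right algebra_simps)
  qed
  \<comment> \<open>V <= C |Z - z|^2 puts V 0 below \<eta>^2, and |Z - z|^2 <= V keeps Z within
    \<eta> of z while V < \<eta>^2. Square roots in the estimate for V produce \<open>sqrt C\<close>
    and r / 2.\<close>
  have "norm (Z t - z) \<le> sqrt C * exp (- (r / 2) * t) * norm (Z 0 - z)"
    if Z: "solution_on g T Z" "norm (Z 0 - z) < \<eta> / sqrt C" and t: "t \<in> {0..T}" for T Z t
  proof -
    define V where "V s = B (Z s - z) (Z s - z)" for s
    have V0: "V 0 \<le> C * (norm (Z 0 - z))\<^sup>2"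
      using C(2)[of "Z 0 - z" "Z 0 - z"] by (simp add: V_def power2_eq_square mult.commute)
    have "(norm (Z t - z))\<^sup>2 \<le> V t"
      using normB[of "Z t - z"] by (simp add: V_def)
    also have "V t \<le> exp (- r * t) * V 0"
    proof (rule lyapunov_decay[OF _ _ _ _ _ t])
      fix s assume s: "s \<in> {0..T}"
      have "((\<lambda>s. Z s - z) has_vector_derivative g (Z s)) (at s within {0..T})"
        using Z(1) s by (auto simp: solution_on_def intro!: derivative_eq_intros)
      from has_vector_derivative[OF this this]
      show "(V has_real_derivative 2 * B (Z s - z) (g (Z s))) (at s within {0..T})"
        unfolding V_def has_real_derivative_iff_has_vector_derivative
        by (simp add: B(2)[of "g (Z s)"])
      show "0 \<le> V s"
        using normB[of "Z s - z"] zero_le_power2[of "norm (Z s - z)"] unfolding V_def by linarith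
      assume "V s < \<eta>\<^sup>2"
      then have "(norm (Z s - z))\<^sup>2 < \<eta>\<^sup>2"
        using normB[of "Z s - z"] unfolding V_def by linarith
      then have "norm (Z s - z) < \<eta>"
        using \<eta>(1) by (simp add: power2_less_imp_less)
      from field[OF this] show "2 * B (Z s - z) (g (Z s)) \<le> - r * V s"
        by (simp add: V_def)
    next
      have "norm (Z 0 - z) * sqrt C < \<eta>"
        using Z(2) C(1) by (simp add: field_simps)
      then have "(norm (Z 0 - z) * sqrt C)\<^sup>2 < \<eta>\<^sup>2"
        using C(1) by (intro power_strict_mono) auto
      then show "V 0 < \<eta>\<^sup>2"
        using V0 C(1) by (simp add: power_mult_distrib mult.commute)
    qed (use B(4) in simp)
    also have "\<dots> \<le> exp (- r * t) * (C * (norm (Z 0 - z))\<^sup>2)"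
      using V0 by simp
    also have "\<dots> = (sqrt C * exp (- (r / 2) * t) * norm (Z 0 - z))\<^sup>2"
      using C(1) by (simp add: power_mult_distrib exp_double[symmetric])
    finally have "(norm (Z t - z))\<^sup>2 \<le> (sqrt C * exp (- (r / 2) * t) * norm (Z 0 - z))\<^sup>2" .
    then show ?thesis
      by (rule power2_le_imp_le) (use C(1) in simp)
  qed
  moreover have "\<eta> / sqrt C > 0" "sqrt C > 0" "r / 2 > 0"
    using C(1) \<eta>(1) B(4) by auto
  ultimately have "exponentially_attracting_at g z"
    unfolding exponentially_attracting_at_def by blast
  then show ?thesis
    by (simp add: exp_stable_equilibria_def g exponentially_attracting_imp_stable)
qed

subsection \<open>Second derivatives and linearization\<close>

text \<open>The mean value theorem along u turns the second difference into t times the u-component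
  of an increment of G over the shift t v. Expanding G at x for both endpoints leaves the main term,
  so differentiability of G at the one point x suffices.\<close>

lemma second_difference_estimate:
  fixes f :: "'a::real_inner \<Rightarrow> real"
  assumes f: "\<And>y. (f has_derivative (\<lambda>h. G y \<bullet> h)) (at y)" and G: "(G has_derivative G') (at x)"
    and "e > 0"
  obtains d where "d > 0" "\<And>t. 0 < t \<Longrightarrow> t < d \<Longrightarrow>
    \<bar>f (x + t *\<^sub>R u + t *\<^sub>R v) - f (x + t *\<^sub>R u) - f (x + t *\<^sub>R v) + f x - t\<^sup>2 * (G' v \<bullet> u)\<bar> \<le> e * t\<^sup>2"
proof -
  \<comment> \<open>The two remainders add up to at most \<epsilon> t (2 |u| + |v|), and
    Cauchy-Schwarz contributes |u|; the added ones keep the divisor positive.\<close>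
  define \<epsilon> where "\<epsilon> = e / ((2 * norm u + norm v + 1) * (norm u + 1))"
  have pos: "(2 * norm u + norm v + 1) * (norm u + 1) > 0"
    by (intro mult_pos_pos add_nonneg_pos add_nonneg_nonneg) auto
  then have "\<epsilon> > 0"
    using \<open>e > 0\<close> by (simp add: \<epsilon>_def)
  then obtain \<eta> where \<eta>: "\<eta> > 0"
      "\<And>y. norm (y - x) < \<eta> \<Longrightarrow> norm (G y - G x - G' (y - x)) \<le> \<epsilon> * norm (y - x)"
    using G unfolding has_derivative_at_alt by fastforce
  interpret G': bounded_linear G'
    using G by (rule has_derivative_bounded_linear)
  define d where "d = \<eta> / (norm u + norm v + 1)"
  show ?thesis
  proof (rule that)
    show "d > 0"
      using \<eta>(1) by (simp add: d_def add_nonneg_pos)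
    fix t :: real assume t: "0 < t" "t < d"
    have small: "t * (norm u + norm v) < \<eta>"
    proof -
      have "norm u + norm v + 1 > 0"
        by (simp add: add_nonneg_pos)
      then have "t * (norm u + norm v + 1) < \<eta>"
        using t(2) unfolding d_def by (simp only: pos_less_divide_eq)
      then show ?thesis
        using t(1) by (simp add: algebra_simps)
    qed
    define \<psi> where "\<psi> s = f (x + s *\<^sub>R u + t *\<^sub>R v) - f (x + s *\<^sub>R u)" for s
    have "\<exists>s>0. s < t \<and> \<psi> t - \<psi> 0 =
        (t - 0) * (G (x + s *\<^sub>R u + t *\<^sub>R v) \<bullet> u - G (x + s *\<^sub>R u) \<bullet> u)"
    proof (rule MVT2[OF t(1)])
      fix s :: real
      have *: "((\<lambda>s. x + s *\<^sub>R u + t *\<^sub>R v) has_derivative (\<lambda>h. h *\<^sub>R u)) (at s)"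
        "((\<lambda>s. x + s *\<^sub>R u) has_derivative (\<lambda>h. h *\<^sub>R u)) (at s)"
        by (auto intro!: derivative_eq_intros)
      show "(\<psi> has_real_derivative
          G (x + s *\<^sub>R u + t *\<^sub>R v) \<bullet> u - G (x + s *\<^sub>R u) \<bullet> u) (at s)"
        unfolding \<psi>_def has_field_derivative_def
        by (rule has_derivative_eq_rhs[OF has_derivative_diff[OF
              has_derivative_compose[OF *(1) f] has_derivative_compose[OF *(2) f]]])
          (simp add: fun_eq_iff algebra_simps)
    qed
    then obtain s where s: "0 < s" "s < t" "\<psi> t - \<psi> 0 =
        t * (G (x + s *\<^sub>R u + t *\<^sub>R v) \<bullet> u - G (x + s *\<^sub>R u) \<bullet> u)"
      by auto
    define R where "R y = G y - G x - G' (y - x)" for y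
    have near: "norm (s *\<^sub>R u + c *\<^sub>R v) \<le> t * (norm u + norm v)" if "c \<in> {0, t}" for c
    proof -
      have "norm (s *\<^sub>R u + c *\<^sub>R v) \<le> s * norm u + \<bar>c\<bar> * norm v"
        using norm_triangle_ineq[of "s *\<^sub>R u" "c *\<^sub>R v"] s(1) by simp
      also have "\<dots> \<le> t * norm u + t * norm v"
        using s t that by (intro add_mono mult_right_mono) auto
      finally show ?thesis
        by (simp add: distrib_left)
    qed
    have R1: "norm (R (x + s *\<^sub>R u + t *\<^sub>R v)) \<le> \<epsilon> * (t * (norm u + norm v))"
    proof -
      have "norm (R (x + s *\<^sub>R u + t *\<^sub>R v)) \<le> \<epsilon> * norm (s *\<^sub>R u + t *\<^sub>R v)"
        using \<eta>(2)[of "x + s *\<^sub>R u + t *\<^sub>R v"] near[of t] small by (simp add: R_def add.assoc)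
      also have "\<dots> \<le> \<epsilon> * (t * (norm u + norm v))"
        using near[of t] \<open>\<epsilon> > 0\<close> by (intro mult_left_mono) auto
      finally show ?thesis .
    qed
    have R2: "norm (R (x + s *\<^sub>R u)) \<le> \<epsilon> * (t * norm u)"
    proof -
      have "norm (R (x + s *\<^sub>R u)) \<le> \<epsilon> * norm (s *\<^sub>R u)"
        using \<eta>(2)[of "x + s *\<^sub>R u"] near[of 0] small by (simp add: R_def)
      also have "\<dots> \<le> \<epsilon> * (t * norm u)"
        using s \<open>\<epsilon> > 0\<close> by (intro mult_left_mono) (auto intro: mult_right_mono)
      finally show ?thesis .
    qed
    have dG: "G (x + s *\<^sub>R u + t *\<^sub>R v) - G (x + s *\<^sub>R u)
        = t *\<^sub>R G' v + (R (x + s *\<^sub>R u + t *\<^sub>R v) - R (x + s *\<^sub>R u))"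
      by (simp add: R_def add.assoc G'.add G'.scaleR)
    have "\<psi> t - \<psi> 0 - t\<^sup>2 * (G' v \<bullet> u) = t * ((R (x + s *\<^sub>R u + t *\<^sub>R v) - R (x + s *\<^sub>R u)) \<bullet> u)"
      by (simp only: s(3) inner_diff_left[symmetric] dG)
        (simp add: inner_add_left power2_eq_square algebra_simps)
    moreover have "\<bar>(R (x + s *\<^sub>R u + t *\<^sub>R v) - R (x + s *\<^sub>R u)) \<bullet> u\<bar> \<le> e * t"
    proof -
      have "\<bar>(R (x + s *\<^sub>R u + t *\<^sub>R v) - R (x + s *\<^sub>R u)) \<bullet> u\<bar>
          \<le> norm (R (x + s *\<^sub>R u + t *\<^sub>R v) - R (x + s *\<^sub>R u)) * norm u"
        by (rule Cauchy_Schwarz_ineq2)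
      also have "\<dots> \<le> (\<epsilon> * t * (2 * norm u + norm v + 1)) * (norm u + 1)"
      proof (rule mult_mono)
        have "norm (R (x + s *\<^sub>R u + t *\<^sub>R v) - R (x + s *\<^sub>R u)) \<le> \<epsilon> * t * (2 * norm u + norm v)"
          using norm_triangle_ineq4[of "R (x + s *\<^sub>R u + t *\<^sub>R v)" "R (x + s *\<^sub>R u)"] R1 R2
          by (simp add: algebra_simps)
        also have "\<dots> \<le> \<epsilon> * t * (2 * norm u + norm v + 1)"
          using \<open>\<epsilon> > 0\<close> t by (intro mult_left_mono) auto
        finally show "norm (R (x + s *\<^sub>R u + t *\<^sub>R v) - R (x + s *\<^sub>R u))
            \<le> \<epsilon> * t * (2 * norm u + norm v + 1)" .
      qed (use \<open>\<epsilon> > 0\<close> t in auto)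
      also have "\<dots> = t * (\<epsilon> * ((2 * norm u + norm v + 1) * (norm u + 1)))"
        by (simp add: mult_ac)
      also have "\<epsilon> * ((2 * norm u + norm v + 1) * (norm u + 1)) = e"
        using pos unfolding \<epsilon>_def by (metis nonzero_eq_divide_eq less_irrefl)
      finally show ?thesis
        by (simp add: mult.commute)
    qed
    ultimately have "\<bar>\<psi> t - \<psi> 0 - t\<^sup>2 * (G' v \<bullet> u)\<bar> \<le> t * (e * t)"
      using t by (simp add: abs_mult)
    then show "\<bar>f (x + t *\<^sub>R u + t *\<^sub>R v) - f (x + t *\<^sub>R u) - f (x + t *\<^sub>R v) + f x - t\<^sup>2 * (G' v \<bullet> u)\<bar>
        \<le> e * t\<^sup>2"
      by (simp add: \<psi>_def power2_eq_square mult_ac algebra_simps)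
  qed
qed

text \<open>The second difference is symmetric in u and v, so at a common small t both sides, scaled
  by t^2, approximate the same number within e/2 t^2, with e arbitrary.\<close>

lemma symmetric_second_derivative:
  fixes f :: "'a::real_inner \<Rightarrow> real"
  assumes f: "\<And>y. (f has_derivative (\<lambda>h. G y \<bullet> h)) (at y)" and G: "(G has_derivative G') (at x)"
  shows "G' u \<bullet> v = G' v \<bullet> u"
proof -
  have "\<bar>G' u \<bullet> v - G' v \<bullet> u\<bar> \<le> 0 + e" if "e > 0" for e
  proof -
    have "e / 2 > 0"
      using that by simp
    obtain d1 where d1: "d1 > 0" "\<And>t. 0 < t \<Longrightarrow> t < d1 \<Longrightarrow>
        \<bar>f (x + t *\<^sub>R u + t *\<^sub>R v) - f (x + t *\<^sub>R u) - f (x + t *\<^sub>R v) + f x - t\<^sup>2 * (G' v \<bullet> u)\<bar> \<le> e / 2 * t\<^sup>2"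
      by (rule second_difference_estimate[OF f G \<open>e / 2 > 0\<close>]) blast
    obtain d2 where d2: "d2 > 0" "\<And>t. 0 < t \<Longrightarrow> t < d2 \<Longrightarrow>
        \<bar>f (x + t *\<^sub>R v + t *\<^sub>R u) - f (x + t *\<^sub>R v) - f (x + t *\<^sub>R u) + f x - t\<^sup>2 * (G' u \<bullet> v)\<bar> \<le> e / 2 * t\<^sup>2"
      by (rule second_difference_estimate[OF f G \<open>e / 2 > 0\<close>]) blast
    define t where "t = min d1 d2 / 2"
    have t: "0 < t" "t < d1" "t < d2"
      using d1(1) d2(1) by (auto simp: t_def)
    have swap: "x + t *\<^sub>R v + t *\<^sub>R u = x + t *\<^sub>R u + t *\<^sub>R v"
      by (simp add: algebra_simps)
    have "\<bar>t\<^sup>2 * (G' u \<bullet> v) - t\<^sup>2 * (G' v \<bullet> u)\<bar> \<le> e * t\<^sup>2"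
      using d1(2)[OF t(1,2)] d2(2)[OF t(1,3)] unfolding swap by linarith
    moreover have "\<bar>t\<^sup>2 * (G' u \<bullet> v) - t\<^sup>2 * (G' v \<bullet> u)\<bar> = t\<^sup>2 * \<bar>G' u \<bullet> v - G' v \<bullet> u\<bar>"
      by (simp add: abs_mult flip: right_diff_distrib)
    ultimately have "t\<^sup>2 * \<bar>G' u \<bullet> v - G' v \<bullet> u\<bar> \<le> t\<^sup>2 * e"
      by (simp only: mult.commute)
    then show ?thesis
      using t(1) by simp
  qed
  then have "\<bar>G' u \<bullet> v - G' v \<bullet> u\<bar> \<le> 0"
    by (rule field_le_epsilon)
  then show ?thesis
    by simp
qed

text \<open>Restrict f to the line through x along u. As the directional derivative vanishes at x, a
  negative second derivative would make it negative just after x, and the mean value theorem would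
  give a value below f x.\<close>

lemma local_min_second_order:
  fixes f :: "'a::real_inner \<Rightarrow> real"
  assumes f: "\<And>y. (f has_derivative (\<lambda>h. G y \<bullet> h)) (at y)" and G: "(G has_derivative G') (at x)"
    and "d > 0" and min: "\<And>t. \<bar>t\<bar> < d \<Longrightarrow> f x \<le> f (x + t *\<^sub>R u)"
  shows "G x \<bullet> u = 0" and "0 \<le> G' u \<bullet> u"
proof -
  have line: "((\<lambda>t. x + t *\<^sub>R u) has_derivative (\<lambda>h. h *\<^sub>R u)) (at t)" for t
    by (auto intro!: derivative_eq_intros)
  have d1: "((\<lambda>t. f (x + t *\<^sub>R u)) has_real_derivative G (x + t *\<^sub>R u) \<bullet> u) (at t)" for t
    unfolding has_field_derivative_def
    by (rule has_derivative_eq_rhs[OF has_derivative_compose[OF line f]]) (simp add: fun_eq_iff)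
  have "((\<lambda>t. f (x + t *\<^sub>R u)) has_real_derivative G x \<bullet> u) (at 0)"
    using d1[of 0] by simp
  then show zero: "G x \<bullet> u = 0"
    by (rule DERIV_local_min[OF _ \<open>d > 0\<close>]) (use min in auto)
  have "(G has_derivative G') (at (x + 0 *\<^sub>R u))"
    using G by simp
  from has_derivative_inner_left[OF has_derivative_compose[OF line this], of u]
  have d2: "((\<lambda>t. G (x + t *\<^sub>R u) \<bullet> u) has_real_derivative G' u \<bullet> u) (at 0)"
    unfolding has_field_derivative_def
    by (rule has_derivative_eq_rhs) (simp add: fun_eq_iff linear_scale[OF has_derivative_linear[OF G]])
  show "0 \<le> G' u \<bullet> u"
  proof (rule ccontr)
    assume "\<not> ?thesis"
    then obtain c where c: "c > 0" "\<And>h. 0 < h \<Longrightarrow> h < c \<Longrightarrow> G (x + h *\<^sub>R u) \<bullet> u < 0"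
      using DERIV_neg_dec_right[OF d2] zero by auto
    define t where "t = min c d / 2"
    have t: "0 < t" "t < c" "t < d"
      using c(1) \<open>d > 0\<close> by (auto simp: t_def)
    obtain s where "0 < s" "s < t" "f (x + t *\<^sub>R u) - f (x + 0 *\<^sub>R u) = (t - 0) * (G (x + s *\<^sub>R u) \<bullet> u)"
      using MVT2[OF t(1), of "\<lambda>t. f (x + t *\<^sub>R u)" "\<lambda>t. G (x + t *\<^sub>R u) \<bullet> u"] d1 by blast
    then have "f (x + t *\<^sub>R u) < f x"
      using c(2)[of s] t mult_pos_neg[of t "G (x + s *\<^sub>R u) \<bullet> u"] by simp
    then show False
      using min[of t] t by simp
  qed
qed

text \<open>Difference quotients along h are bounded by L |h|; one quotient with a small step t is
  compared with the derivative, and e absorbs the linearization error.\<close>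

lemma lipschitz_norm_derivative_le:
  fixes g :: "'a::real_normed_vector \<Rightarrow> 'b::real_normed_vector"
  assumes lip: "L-lipschitz_on UNIV g" and der: "(g has_derivative g') (at x)"
  shows "norm (g' h) \<le> L * norm h"
proof (rule field_le_epsilon)
  fix e :: real assume "e > 0"
  define \<epsilon> where "\<epsilon> = e / (norm h + 1)"
  have "\<epsilon> > 0"
    using \<open>e > 0\<close> by (simp add: \<epsilon>_def add_nonneg_pos)
  then obtain d where d: "d > 0" "\<And>y. norm (y - x) < d \<Longrightarrow> norm (g y - g x - g' (y - x)) \<le> \<epsilon> * norm (y - x)"
    using der unfolding has_derivative_at_alt by fastforce
  define t where "t = d / 2 / (norm h + 1)"
  have t: "t > 0"
    using d(1) by (simp add: t_def add_nonneg_pos)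
  have "norm h + 1 > 0"
    by (simp add: add_nonneg_pos)
  then have "t * (norm h + 1) = d / 2"
    unfolding t_def by (metis nonzero_eq_divide_eq less_irrefl)
  then have "t * (norm h + 1) < d"
    using d(1) by simp
  then have th: "t * norm h < d"
    using t by (simp add: algebra_simps)
  have "norm (g' (t *\<^sub>R h)) \<le> norm (g (x + t *\<^sub>R h) - g x) + norm (g (x + t *\<^sub>R h) - g x - g' (t *\<^sub>R h))"
    by (metis add_diff_cancel_left' diff_diff_eq2 norm_triangle_ineq4 diff_add_cancel)
  also have "\<dots> \<le> L * (t * norm h) + \<epsilon> * (t * norm h)"
    using lipschitz_onD[OF lip, of "x + t *\<^sub>R h" x] d(2)[of "x + t *\<^sub>R h"] t th
    by (intro add_mono) (auto simp: dist_norm)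
  finally have "t * norm (g' h) \<le> t * ((L + \<epsilon>) * norm h)"
    using t linear_scale[OF has_derivative_linear[OF der]] by (simp add: algebra_simps)
  then have "norm (g' h) \<le> (L + \<epsilon>) * norm h"
    using t by simp
  also have "\<epsilon> * (norm h + 1) = e"
    using \<open>norm h + 1 > 0\<close> unfolding \<epsilon>_def by (metis nonzero_eq_divide_eq less_irrefl)
  then have "\<epsilon> * norm h \<le> e"
    using \<open>\<epsilon> > 0\<close> by (simp add: distrib_left)
  then have "(L + \<epsilon>) * norm h \<le> L * norm h + e"
    by (simp add: algebra_simps)
  finally show "norm (g' h) \<le> L * norm h + e" .
qed

text \<open>A product rule with M merely continuous: since w z = 0, |w y| is O(|y - z|), so the term
  with M y - M z is o(|y - z|). It serves for \<open>ode_Os\<close>, whose Hessian factor is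
  continuous but need not be differentiable.\<close>

lemma has_derivative_bilinear_at_zero:
  assumes "bounded_bilinear B"
    and M: "isCont M z" and w: "(w has_derivative w') (at z)" and z: "w z = 0"
  shows "((\<lambda>x. B (M x) (w x)) has_derivative (\<lambda>h. B (M z) (w' h))) (at z)"
proof -
  interpret bounded_bilinear B by fact
  interpret w': bounded_linear w'
    using w by (rule has_derivative_bounded_linear)
  obtain K where K: "K > 0" "\<And>a b. norm (B a b) \<le> norm a * norm b * K"
    using pos_bounded by blast
  obtain C where C: "C > 0" "\<And>h. norm (w' h) \<le> norm h * C"
    using w'.pos_bounded by blast
  obtain d1 where d1: "d1 > 0" "\<And>y. norm (y - z) < d1 \<Longrightarrow> norm (w y - w z - w' (y - z)) \<le> 1 * norm (y - z)"
    using w unfolding has_derivative_at_alt by (metis zero_less_one)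
  have "((\<lambda>x. B (M x - M z) (w x)) has_derivative (\<lambda>h. 0)) (at z)"
    unfolding has_derivative_at_alt
  proof (intro conjI allI impI)
    fix e :: real assume "e > 0"
    \<comment> \<open>Near z, |w y| <= (C + 1) |y - z|: C comes from the derivative and 1 from the
      remainder.\<close>
    define \<epsilon> where "\<epsilon> = e / ((C + 1) * K)"
    have "\<epsilon> > 0"
      using \<open>e > 0\<close> C K by (simp add: \<epsilon>_def)
    then obtain d2 where d2: "d2 > 0" "\<And>y. norm (y - z) < d2 \<Longrightarrow> norm (M y - M z) < \<epsilon>"
      using M unfolding continuous_at_eps_delta dist_norm by meson
    have "norm (B (M y - M z) (w y)) \<le> e * norm (y - z)" if y: "norm (y - z) < min d1 d2" for y
    proof -
      have "norm (w y) \<le> norm (w y - w' (y - z)) + norm (w' (y - z))"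
        by (metis diff_add_cancel norm_triangle_ineq)
      then have "norm (w y) \<le> (C + 1) * norm (y - z)"
        using d1(2)[of y] C(2)[of "y - z"] y by (simp add: z algebra_simps)
      moreover have "norm (M y - M z) \<le> \<epsilon>"
        using d2(2)[of y] y by simp
      ultimately have "norm (M y - M z) * norm (w y) * K \<le> \<epsilon> * ((C + 1) * norm (y - z)) * K"
        using \<open>\<epsilon> > 0\<close> K(1) by (intro mult_right_mono mult_mono) auto
      also have "\<dots> = e * norm (y - z)"
        using C K by (simp add: \<epsilon>_def)
      finally show ?thesis
        using K(2)[of "M y - M z" "w y"] by linarith
    qed
    then show "\<exists>d>0. \<forall>y. norm (y - z) < d \<longrightarrow>
        norm (B (M y - M z) (w y) - B (M z - M z) (w z) - 0) \<le> e * norm (y - z)"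
      using d1(1) d2(1) by (intro exI[of _ "min d1 d2"]) (auto simp: z zero_right)
  qed simp
  moreover have "((\<lambda>x. B (M z) (w x)) has_derivative (\<lambda>h. B (M z) (w' h))) (at z)"
    by (rule bounded_linear.has_derivative[OF bounded_linear_right w])
  ultimately have "((\<lambda>x. B (M x - M z) (w x) + B (M z) (w x)) has_derivative (\<lambda>h. 0 + B (M z) (w' h))) (at z)"
    by (rule has_derivative_add)
  then show ?thesis
    by (simp add: diff_left)
qed

subsection \<open>Location of eigenvalues\<close>

text \<open>Real and imaginary parts of an eigenvector let inner-product estimates for the real
  matrix constrain a complex eigenvalue.\<close>

lemma spectrum_real_imag:
  assumes "\<mu> \<in> spectrum A"
  obtains a b where "a \<noteq> 0 \<or> b \<noteq> 0"
    "A *v a = Re \<mu> *\<^sub>R a - Im \<mu> *\<^sub>R b" "A *v b = Im \<mu> *\<^sub>R a + Re \<mu> *\<^sub>R b"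
proof -
  obtain v where v: "v \<noteq> 0" "map_matrix complex_of_real A *v v = \<mu> *s v"
    using assms by (auto simp: spectrum_def)
  define a b where "a = (\<chi> i. Re (v $ i))" and "b = (\<chi> i. Im (v $ i))"
  have "(map_matrix complex_of_real A *v v) $ i = (\<mu> *s v) $ i" for i
    using v(2) by simp
  then have *: "(\<Sum>j\<in>UNIV. complex_of_real (A $ i $ j) * v $ j) = \<mu> * v $ i" for i
    by (simp add: matrix_vector_mult_def)
  have "(\<Sum>j\<in>UNIV. A $ i $ j * Re (v $ j)) = Re \<mu> * Re (v $ i) - Im \<mu> * Im (v $ i)"
    "(\<Sum>j\<in>UNIV. A $ i $ j * Im (v $ j)) = Re \<mu> * Im (v $ i) + Im \<mu> * Re (v $ i)" for i
    using arg_cong[OF *, of Re i] arg_cong[OF *, of Im i] by simp_all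
  then have "A *v a = Re \<mu> *\<^sub>R a - Im \<mu> *\<^sub>R b" "A *v b = Im \<mu> *\<^sub>R a + Re \<mu> *\<^sub>R b"
    by (simp_all add: a_def b_def vec_eq_iff matrix_vector_mult_def)
  moreover have "a \<noteq> 0 \<or> b \<noteq> 0"
    using v(1) by (auto simp: a_def b_def vec_eq_iff complex_eq_iff)
  ultimately show ?thesis
    using that by blast
qed

text \<open>Adding the forms at the real and imaginary parts of an eigenvector cancels the Im \<mu>
  terms, by symmetry of P, and leaves Re \<mu> times a positive number.\<close>

lemma spectrum_weighted_Re:
  assumes "\<mu> \<in> spectrum A"
    and sym: "\<And>v w. (P *v v) \<bullet> w = (P *v w) \<bullet> v"
    and pos: "\<And>v. v \<noteq> 0 \<Longrightarrow> (P *v v) \<bullet> v > 0"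
    and A: "\<And>v. (P *v v) \<bullet> (A *v v) \<le> 0"
  shows "Re \<mu> \<le> 0"
proof -
  obtain a b where ab: "a \<noteq> 0 \<or> b \<noteq> 0"
    "A *v a = Re \<mu> *\<^sub>R a - Im \<mu> *\<^sub>R b" "A *v b = Im \<mu> *\<^sub>R a + Re \<mu> *\<^sub>R b"
    using spectrum_real_imag[OF assms(1)] .
  have nonneg: "(P *v v) \<bullet> v \<ge> 0" for v
    using pos[of v] by (cases "v = 0") auto
  have "(P *v a) \<bullet> (A *v a) + (P *v b) \<bullet> (A *v b) = Re \<mu> * ((P *v a) \<bullet> a + (P *v b) \<bullet> b)"
    unfolding ab by (simp add: inner_diff_right inner_add_right sym[of b a] algebra_simps)
  then have "Re \<mu> * ((P *v a) \<bullet> a + (P *v b) \<bullet> b) \<le> 0"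
    using A[of a] A[of b] by simp
  moreover have "(P *v a) \<bullet> a + (P *v b) \<bullet> b > 0"
    using ab(1) pos[of a] pos[of b] nonneg[of a] nonneg[of b] by (meson add_nonneg_pos add_pos_nonneg)
  ultimately show ?thesis
    by (simp add: mult_le_0_iff)
qed

text \<open>In |A a|^2 + |A b|^2 the mixed terms cancel, leaving |\<mu>|^2 (|a|^2 + |b|^2).\<close>

lemma spectrum_norm_bound:
  assumes "\<mu> \<in> spectrum A" and A: "\<And>v. norm (A *v v) \<le> c * norm v"
  shows "(cmod \<mu>)\<^sup>2 \<le> c\<^sup>2"
proof -
  obtain a b where ab: "a \<noteq> 0 \<or> b \<noteq> 0"
    "A *v a = Re \<mu> *\<^sub>R a - Im \<mu> *\<^sub>R b" "A *v b = Im \<mu> *\<^sub>R a + Re \<mu> *\<^sub>R b"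
    using spectrum_real_imag[OF assms(1)] .
  have sq: "(A *v v) \<bullet> (A *v v) \<le> c\<^sup>2 * (v \<bullet> v)" for v
  proof -
    have "(norm (A *v v))\<^sup>2 \<le> (c * norm v)\<^sup>2"
      using A by (intro power_mono) auto
    then show ?thesis
      by (simp add: power2_norm_eq_inner power_mult_distrib)
  qed
  have "(A *v a) \<bullet> (A *v a) + (A *v b) \<bullet> (A *v b) = (cmod \<mu>)\<^sup>2 * (a \<bullet> a + b \<bullet> b)"
    unfolding ab cmod_power2
    by (simp add: inner_diff inner_add inner_commute[of b a] power2_eq_square algebra_simps)
  then have "(cmod \<mu>)\<^sup>2 * (a \<bullet> a + b \<bullet> b) \<le> c\<^sup>2 * (a \<bullet> a + b \<bullet> b)"
    using sq[of a] sq[of b] by (simp add: distrib_left)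
  moreover have "a \<bullet> a + b \<bullet> b > 0"
    using ab(1) by (meson add_nonneg_pos add_pos_nonneg inner_ge_zero inner_gt_zero_iff)
  ultimately show ?thesis
    by simp
qed

text \<open>For X - c X^2, this is the half of the spectral mapping theorem that confines the new
  spectrum; a quadratic can be factored explicitly.\<close>

lemma spectrum_quadratic:
  fixes A :: "real^'k::finite^'k"
  assumes \<nu>: "\<nu> \<in> spectrum (A - c *\<^sub>R (A ** A))" and "c \<noteq> 0"
  obtains \<mu> where "\<mu> \<in> spectrum A" "\<nu> = \<mu> - of_real c * \<mu>\<^sup>2"
proof -
  let ?c = "complex_of_real c"
  define M where "M = map_matrix complex_of_real A"
  have "map_matrix complex_of_real (A - c *\<^sub>R (A ** A)) *v v = M *v v - ?c *s (M *v (M *v v))" for v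
    unfolding matrix_vector_mul_assoc
    by (simp add: M_def vec_eq_iff matrix_vector_mult_def matrix_matrix_mult_def left_diff_distrib
        sum_subtractf sum_distrib_left sum_distrib_right mult.assoc)
  then obtain v where v: "v \<noteq> 0" "M *v v - ?c *s (M *v (M *v v)) = \<nu> *s v"
    using \<nu> by (auto simp: spectrum_def)
  \<comment> \<open>The quadratic formula for c X^2 - X + \<nu> = 0.\<close>
  define \<alpha> where "\<alpha> = (1 - csqrt (1 - 4 * ?c * \<nu>)) / (2 * ?c)"
  have "4 * ?c * (\<alpha> - ?c * \<alpha>\<^sup>2) = 1 - (csqrt (1 - 4 * ?c * \<nu>))\<^sup>2"
    using \<open>c \<noteq> 0\<close> by (simp add: \<alpha>_def field_simps power2_eq_square del: power2_csqrt)
  then have \<alpha>: "\<nu> = \<alpha> - ?c * \<alpha>\<^sup>2"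
    using \<open>c \<noteq> 0\<close> by simp
  \<comment> \<open>\<open>X - c X\<^sup>2 - \<nu> = (X - \<alpha>) (1 - c (X + \<alpha>))\<close>; if the second factor kills \<open>v\<close>, then \<open>v\<close> belongs to the other root.\<close>
  define w where "w = v - ?c *s (M *v v + \<alpha> *s v)"
  have "M *v w - \<alpha> *s w = (M *v v - ?c *s (M *v (M *v v))) - (\<alpha> - ?c * \<alpha>\<^sup>2) *s v"
    by (simp add: w_def vec.diff vec.add vec.scale vec.scale_right_diff_distrib vec.scale_left_diff_distrib
        vec.scale_right_distrib vector_smult_assoc power2_eq_square algebra_simps)
  then have w: "M *v w = \<alpha> *s w"
    by (simp add: v(2) \<alpha>)
  show ?thesis
  proof (cases "w = 0")
    case False
    then show ?thesis
      using that[of \<alpha>] w \<alpha> by (auto simp: spectrum_def M_def)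
  next
    case True
    \<comment> \<open>The two roots of that quadratic sum to 1 / c.\<close>
    define \<beta> where "\<beta> = 1 / ?c - \<alpha>"
    have "v = ?c *s (M *v v) + (?c * \<alpha>) *s v"
      using True by (simp add: w_def vec.scale_right_distrib vector_smult_assoc)
    then have "?c *s (M *v v) = (1 - ?c * \<alpha>) *s v"
      by (simp add: vec.scale_left_diff_distrib algebra_simps)
    then have "(1 / ?c) *s (?c *s (M *v v)) = (1 / ?c) *s ((1 - ?c * \<alpha>) *s v)"
      by simp
    moreover have "1 / ?c * ?c = 1" "1 / ?c * (1 - ?c * \<alpha>) = \<beta>"
      using \<open>c \<noteq> 0\<close> by (auto simp: \<beta>_def field_simps)
    ultimately have "M *v v = \<beta> *s v"
      by (simp only: vector_smult_assoc vector_smult_lid)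
    then have "\<beta> \<in> spectrum A"
      using v(1) by (auto simp: spectrum_def M_def)
    moreover have "\<nu> = \<beta> - ?c * \<beta>\<^sup>2"
      using \<open>c \<noteq> 0\<close> by (simp add: \<alpha> \<beta>_def field_simps power2_eq_square)
    ultimately show ?thesis
      by (rule that)
  qed
qed

text \<open>Since -Re(\<mu>^2) <= |\<mu>|^2 <= m, the quadratic term adds at most s m / 2 < |Re
  \<mu>| to the real part.\<close>

lemma Re_quadratic_neg:
  fixes \<mu> :: complex
  assumes "Re \<mu> < 0" "0 < s" "(cmod \<mu>)\<^sup>2 \<le> m" "m > 0" "s < 2 * \<bar>Re \<mu>\<bar> / m"
  shows "Re (\<mu> - of_real (s / 2) * \<mu>\<^sup>2) < 0"
proof -
  have "s * m < 2 * \<bar>Re \<mu>\<bar>"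
    using assms(4,5) by (simp add: field_simps)
  then have "s * (cmod \<mu>)\<^sup>2 < - 2 * Re \<mu>"
    using assms(1-3) mult_left_mono[of "(cmod \<mu>)\<^sup>2" m s] by linarith
  moreover have "- Re (\<mu>\<^sup>2) \<le> (cmod \<mu>)\<^sup>2"
    using abs_Re_le_cmod[of "\<mu>\<^sup>2"] by (simp add: norm_power)
  then have "- (s * Re (\<mu>\<^sup>2)) \<le> s * (cmod \<mu>)\<^sup>2"
    using mult_left_mono[of "- Re (\<mu>\<^sup>2)" "(cmod \<mu>)\<^sup>2" s] assms(2) by simp
  ultimately have "- (s * Re (\<mu>\<^sup>2)) < - 2 * Re \<mu>"
    by linarith
  then show ?thesis
    by (simp add: Re_complex_of_real)
qed

subsection \<open>Saddle points\<close>

lemma C2_has_derivative: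
  assumes "C2 f"
  shows "(f has_derivative (\<lambda>h. grad f z \<bullet> h)) (at z)"
proof -
  have d: "(f has_derivative frechet_derivative f (at z)) (at z)"
    using assms by (simp add: C2_def frechet_derivative_works[symmetric])
  have "frechet_derivative f (at z) h = grad f z \<bullet> h" for h
  proof -
    have "frechet_derivative f (at z) h = frechet_derivative f (at z) (\<Sum>i\<in>UNIV. (h $ i) *\<^sub>R axis i 1)"
      using basis_expansion[of h] by (simp add: scalar_mult_eq_scaleR)
    also have "\<dots> = (\<Sum>i\<in>UNIV. h $ i * frechet_derivative f (at z) (axis i 1))"
      by (simp add: linear_sum[OF has_derivative_linear[OF d]] linear_scale[OF has_derivative_linear[OF d]])
    finally show ?thesis
      by (simp add: grad_def inner_vec_def mult.commute)
  qed
  then have "frechet_derivative f (at z) = (\<lambda>h. grad f z \<bullet> h)"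
    by auto
  with d show ?thesis
    by simp
qed

lemma C2_grad_has_derivative:
  assumes "C2 f"
  shows "(grad f has_derivative (*v) (hessian f z)) (at z)"
  using assms by (simp add: C2_def hessian_def jacobian_works)

lemma jacobian_mult:
  fixes f :: "real^'a::finite \<Rightarrow> real^'b::finite"
  assumes "(f has_derivative f') (at z)"
  shows "jacobian f (at z) *v h = f' h"
  using assms has_derivative_unique[OF _ assms] by (metis differentiableI jacobian_works)

text \<open>The matrix diag(I, -I), which turns the gradient into the saddle field. As a
  self-adjoint isometric involution it lets symmetry and norm bounds pass from the Hessian to the
  Jacobian of that field.\<close>

definition flip :: "real^('n::finite + 'm::finite) \<Rightarrow> real^('n + 'm)" where
  "flip v = (\<chi> k. case k of Inl i \<Rightarrow> v $ Inl i | Inr j \<Rightarrow> - (v $ Inr j))"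

lemma linear_flip: "linear flip"
  by (rule linearI) (auto simp: flip_def vec_eq_iff split: sum.splits)

lemma inner_flip: "flip v \<bullet> w = v \<bullet> flip w"
  unfolding inner_vec_def by (rule sum.cong) (auto simp: flip_def split: sum.splits)

lemma flip_flip [simp]: "flip (flip v) = v"
  by (auto simp: flip_def vec_eq_iff split: sum.splits)

lemma norm_flip: "norm (flip v) = norm v"
  by (simp add: norm_eq_sqrt_inner inner_flip)

lemma saddle_field_flip: "saddle_field f z = flip (grad f z)"
  by (simp add: saddle_field_def flip_def)

lemma saddle_field_has_derivative:
  assumes "C2 f"
  shows "(saddle_field f has_derivative (\<lambda>h. flip (hessian f z *v h))) (at z)"
  unfolding saddle_field_flip[abs_def]
  by (rule bounded_linear.has_derivative[OF _ C2_grad_has_derivative[OF assms]])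
    (simp add: linear_conv_bounded_linear[symmetric] linear_flip)

lemma saddle_jacobian_mult:
  "C2 f \<Longrightarrow> jacobian (saddle_field f) (at z) *v h = flip (hessian f z *v h)"
  by (rule jacobian_mult[OF saddle_field_has_derivative])

lemma H_matrix_mult:
  assumes "C2 f"
  shows "H_matrix f z *v h = - flip (hessian f z *v h)"
proof -
  have "H_matrix f z *v h = - (jacobian (saddle_field f) (at z) *v h)"
    by (simp add: H_matrix_def vec_eq_iff matrix_vector_mult_def sum_negf)
  then show ?thesis
    by (simp add: saddle_jacobian_mult[OF assms])
qed

lemma join_split: "w = join (\<chi> i. w $ Inl i) 0 + join 0 (\<chi> j. w $ Inr j)"
  by (auto simp: join_def vec_eq_iff split: sum.splits)

lemma flip_split: "flip w = join (\<chi> i. w $ Inl i) 0 - join 0 (\<chi> j. w $ Inr j)"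
  by (auto simp: join_def vec_eq_iff flip_def split: sum.splits)

lemma join_add_scaleR:
  "join (x + t *\<^sub>R a) (y + t *\<^sub>R b) = join x y + t *\<^sub>R join a b"
  by (auto simp: join_def vec_eq_iff split: sum.splits)

text \<open>Along every line in an x direction f has a local minimum at z, and along every line in a
  y direction -f does, so the one-dimensional conditions apply to f and to -f.\<close>

lemma saddle_point_grad:
  fixes f :: "real^('n::finite + 'm::finite) \<Rightarrow> real"
  assumes C2: "C2 f" and z: "z \<in> saddle_points f"
  shows "grad f z \<bullet> join a 0 = 0" "grad f z \<bullet> join 0 b = 0"
    "0 \<le> (hessian f z *v join a 0) \<bullet> join a 0" "(hessian f z *v join 0 b) \<bullet> join 0 b \<le> 0"
proof -
  obtain xs ys U where U: "z = join xs ys" "open U" "join xs ys \<in> U"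
      "\<And>x y. join x y \<in> U \<Longrightarrow> f (join xs y) \<le> f (join xs ys) \<and> f (join xs ys) \<le> f (join x ys)"
    using z by (auto simp: saddle_points_def)
  obtain \<epsilon> where \<epsilon>: "\<epsilon> > 0" "\<And>w. norm (w - z) < \<epsilon> \<Longrightarrow> w \<in> U"
    using U(1-3) by (metis open_dist dist_norm)
  have near: "z + t *\<^sub>R u \<in> U" if "\<bar>t\<bar> < \<epsilon> / (norm u + 1)" for t :: real and u
  proof -
    have "\<bar>t\<bar> * (norm u + 1) < \<epsilon>"
      using that by (simp add: pos_less_divide_eq add_nonneg_pos)
    then have "\<bar>t\<bar> * norm u < \<epsilon>"
      by (simp add: distrib_left)
    then show ?thesis
      by (intro \<epsilon>(2)) simp
  qed
  have d: "\<epsilon> / (norm u + 1) > 0" for u :: "real^('n + 'm)"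
    using \<epsilon>(1) by (simp add: add_nonneg_pos)
  have minx: "f z \<le> f (z + t *\<^sub>R join a 0)" if "\<bar>t\<bar> < \<epsilon> / (norm (join a 0 :: real^('n + 'm)) + 1)" for t
    using near[OF that] U(4)[of "xs + t *\<^sub>R a" ys] join_add_scaleR[of xs t a ys 0]
    by (simp add: U(1))
  have maxy: "- f z \<le> - f (z + t *\<^sub>R join 0 b)" if "\<bar>t\<bar> < \<epsilon> / (norm (join 0 b :: real^('n + 'm)) + 1)" for t
    using near[OF that] U(4)[of xs "ys + t *\<^sub>R b"] join_add_scaleR[of xs t 0 ys b]
    by (simp add: U(1))
  note fd = C2_has_derivative[OF C2] and gd = C2_grad_has_derivative[OF C2, of z]
  show "grad f z \<bullet> join a 0 = 0" "0 \<le> (hessian f z *v join a 0) \<bullet> join a 0"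
    by (rule local_min_second_order[OF fd gd d minx], assumption)+
  have fd': "((\<lambda>y. - f y) has_derivative (\<lambda>h. (- grad f y) \<bullet> h)) (at y)" for y
    using has_derivative_minus[OF fd[of y]] by (simp add: inner_minus_left)
  have gd': "((\<lambda>y. - grad f y) has_derivative (\<lambda>h. - (hessian f z *v h))) (at z)"
    by (rule has_derivative_minus[OF gd])
  show "grad f z \<bullet> join 0 b = 0" "(hessian f z *v join 0 b) \<bullet> join 0 b \<le> 0"
    using local_min_second_order[OF fd' gd' d maxy] by (simp_all add: inner_minus_left)
qed

lemma saddle_field_zero:
  assumes "C2 f" "z \<in> saddle_points f"
  shows "saddle_field f z = 0"
proof -
  have "grad f z \<bullet> w = 0" for w
    by (subst join_split[of w]) (simp add: inner_add_right saddle_point_grad[OF assms])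
  then have "grad f z = 0"
    by (metis inner_eq_zero_iff)
  then show ?thesis
    by (simp add: saddle_field_flip linear_0[OF linear_flip])
qed

lemma hessian_symmetric:
  assumes "C2 f"
  shows "(hessian f z *v u) \<bullet> v = (hessian f z *v v) \<bullet> u"
  by (rule symmetric_second_derivative[OF C2_has_derivative[OF assms] C2_grad_has_derivative[OF assms]])

lemma H_matrix_dissipative:
  fixes f :: "real^('n::finite + 'm::finite) \<Rightarrow> real"
  assumes "C2 f" "z \<in> saddle_points f"
  shows "w \<bullet> (H_matrix f z *v w) \<le> 0"
proof -
  define x where "x = (join (\<chi> i. w $ Inl i) 0 :: real^('n + 'm))"
  define y where "y = (join 0 (\<chi> j. w $ Inr j) :: real^('n + 'm))"
  have w: "w = x + y" "flip w = x - y"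
    unfolding x_def y_def by (rule join_split, rule flip_split)
  have "w \<bullet> (H_matrix f z *v w) = - ((hessian f z *v (x + y)) \<bullet> (x - y))"
    unfolding H_matrix_mult[OF assms(1)] w(2)[symmetric]
    by (simp add: inner_flip[symmetric] inner_commute w(1)[symmetric])
  \<comment> \<open>The two mixed terms are equal by symmetry of the Hessian and occur with opposite
    signs.\<close>
  also have "\<dots> = - ((hessian f z *v x) \<bullet> x) + (hessian f z *v y) \<bullet> y"
    using hessian_symmetric[OF assms(1), of z x y]
    by (simp add: matrix_vector_right_distrib inner_add_left inner_diff_right)
  also have "\<dots> \<le> 0"
    using saddle_point_grad(3)[OF assms, of "\<chi> i. w $ Inl i"] saddle_point_grad(4)[OF assms, of "\<chi> j. w $ Inr j"]
    by (simp add: x_def y_def)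
  finally show ?thesis .
qed

section \<open>The weight Lambda and the spectrum of Lambda H\<close>

lemma Lambda_matrix_nth:
  "(Lambda_matrix \<tau> *v v) $ k = (case k of Inl i \<Rightarrow> 1 / \<tau> | Inr j \<Rightarrow> 1) * v $ k"
  by (simp add: Lambda_matrix_def matrix_vector_mult_def if_distrib[of "\<lambda>x. x * _"] cong: if_cong)

lemma norm_Lambda_matrix_le:
  fixes v :: "real^('n::finite + 'm::finite)"
  assumes "\<tau> > 0"
  shows "norm (Lambda_matrix \<tau> *v v) \<le> max 1 (1 / \<tau>) * norm v"
proof -
  have "\<bar>case k of Inl i \<Rightarrow> 1 / \<tau> | Inr j \<Rightarrow> 1\<bar> \<le> \<bar>max 1 (1 / \<tau>)\<bar>" for k :: "'n + 'm"
    using assms by (simp split: sum.splits)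
  then have "norm (Lambda_matrix \<tau> *v v) \<le> norm (max 1 (1 / \<tau>) *\<^sub>R v)"
    by (intro norm_le_componentwise_cart)
      (simp only: Lambda_matrix_nth vector_scaleR_component real_scaleR_def real_norm_def abs_mult
        mult_right_mono abs_ge_zero)
  then show ?thesis
    by simp
qed

text \<open>The weight \<open>Lambda_matrix (1 / \<tau>)\<close> is the inverse of
  \<open>Lambda_matrix \<tau>\<close>, so it undoes that factor and leaves the quadratic form of
  \<open>H_matrix\<close>, which is nonpositive at a saddle point.\<close>

lemma spectrum_Lambda_H_nonpos:
  fixes f :: "real^('n::finite + 'm::finite) \<Rightarrow> real"
  assumes "C2 f" "z \<in> saddle_points f" "\<tau> > 0" and \<mu>: "\<mu> \<in> spectrum (Lambda_matrix \<tau> ** H_matrix f z)"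
  shows "Re \<mu> \<le> 0"
proof (rule spectrum_weighted_Re[OF \<mu>, where P = "Lambda_matrix (1 / \<tau>)"])
  fix v w :: "real^('n + 'm)"
  show "(Lambda_matrix (1 / \<tau>) *v v) \<bullet> w = (Lambda_matrix (1 / \<tau>) *v w) \<bullet> v"
    by (simp add: inner_vec_def Lambda_matrix_nth mult_ac)
  show "(Lambda_matrix (1 / \<tau>) *v v) \<bullet> v > 0" if nz: "v \<noteq> 0"
  proof -
    obtain k where "v $ k \<noteq> 0"
      using nz by (metis vec_eq_iff zero_index)
    moreover have "(case l of Inl i \<Rightarrow> 1 / (1 / \<tau>) | Inr j \<Rightarrow> 1) > 0" for l :: "'n + 'm"
      using \<open>\<tau> > 0\<close> by (simp split: sum.splits)
    ultimately show ?thesis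
      unfolding inner_vec_def
      by (intro sum_pos2[of _ k]) (auto simp: Lambda_matrix_nth mult.assoc less_imp_le zero_less_mult_iff
          zero_le_mult_iff linorder_neq_iff)
  qed
  have "(Lambda_matrix (1 / \<tau>) *v v) \<bullet> ((Lambda_matrix \<tau> ** H_matrix f z) *v v) = v \<bullet> (H_matrix f z *v v)"
    unfolding matrix_vector_mul_assoc[symmetric] inner_vec_def
    by (rule sum.cong) (use \<open>\<tau> > 0\<close> in \<open>auto simp: Lambda_matrix_nth split: sum.splits\<close>)
  then show "(Lambda_matrix (1 / \<tau>) *v v) \<bullet> ((Lambda_matrix \<tau> ** H_matrix f z) *v v) \<le> 0"
    using H_matrix_dissipative[OF assms(1,2), of v] by simp
qed

text \<open>The Lipschitz constant bounds the Hessian, \<open>flip\<close> preserves norms, and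
  Lambda costs a factor max(1, 1/\<tau>). The square of the product is the denominator in the
  step-size condition.\<close>

lemma spectrum_Lambda_H_bound:
  assumes "C2 f" "L-lipschitz_on UNIV (grad f)" "\<tau> > 0" and \<mu>: "\<mu> \<in> spectrum (Lambda_matrix \<tau> ** H_matrix f z)"
  shows "(cmod \<mu>)\<^sup>2 \<le> max (L ^ 2) (\<tau> powi (-2) * L ^ 2)"
proof -
  have "norm ((Lambda_matrix \<tau> ** H_matrix f z) *v v) \<le> (max 1 (1 / \<tau>) * L) * norm v" for v
  proof -
    have "norm ((Lambda_matrix \<tau> ** H_matrix f z) *v v) \<le> max 1 (1 / \<tau>) * norm (H_matrix f z *v v)"
      unfolding matrix_vector_mul_assoc[symmetric] by (rule norm_Lambda_matrix_le[OF \<open>\<tau> > 0\<close>])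
    also have "norm (H_matrix f z *v v) \<le> L * norm v"
      using lipschitz_norm_derivative_le[OF assms(2) C2_grad_has_derivative[OF assms(1)]]
      by (simp add: H_matrix_mult[OF assms(1)] norm_flip)
    finally show ?thesis
      by (simp add: mult.assoc mult_left_mono)
  qed
  from spectrum_norm_bound[OF \<mu> this]
  have "(cmod \<mu>)\<^sup>2 \<le> (max 1 (1 / \<tau>) * L)\<^sup>2" .
  also have "\<dots> \<le> max (L ^ 2) (\<tau> powi (-2) * L ^ 2)"
    by (cases "1 \<le> 1 / \<tau>") (auto simp: power_mult_distrib power_int_minus field_simps le_max_iff_disj max_def)
  finally show ?thesis .
qed

section \<open>Linearizations of the two ODEs\<close>

lemma ode_O1_has_derivative:
  assumes "C2 f"
  shows "(ode_O1 f \<tau> has_derivative (*v) (Lambda_matrix \<tau> ** H_matrix f z)) (at z)"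
proof -
  have "((\<lambda>z. - (Lambda_matrix \<tau> *v saddle_field f z)) has_derivative
      (\<lambda>h. - (Lambda_matrix \<tau> *v flip (hessian f z *v h)))) (at z)"
    by (intro has_derivative_minus bounded_linear.has_derivative[OF matrix_vector_mul_bounded_linear]
        saddle_field_has_derivative assms)
  then show ?thesis
    unfolding ode_O1_def[abs_def]
    by (rule has_derivative_eq_rhs) (simp add: fun_eq_iff matrix_vector_mul_assoc[symmetric]
        H_matrix_mult[OF assms] linear_neg[OF matrix_vector_mul_linear])
qed

text \<open>The factor w = Lambda F vanishes at z, so the variation of the Hessian does not enter.
  Both the derivative of w and Lambda times the Jacobian of F equal -K at z; their signs cancel, and
  K^2 gets the coefficient -s/2.\<close>

lemma ode_Os_has_derivative:
  fixes f :: "real^('n::finite + 'm::finite) \<Rightarrow> real" and \<tau> s :: real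
  assumes C2: "C2 f" and z: "saddle_field f z = 0"
  defines "K \<equiv> Lambda_matrix \<tau> ** H_matrix f z"
  shows "(ode_Os f \<tau> s has_derivative (*v) (K - (s / 2) *\<^sub>R (K ** K))) (at z)"
proof -
  define w where "w z = Lambda_matrix \<tau> *v saddle_field f z" for z
  have os: "ode_Os f \<tau> s = (\<lambda>x. - (w x + (s / 2) *\<^sub>R (Lambda_matrix \<tau> *v flip (hessian f x *v w x))))"
    by (simp add: fun_eq_iff ode_Os_def w_def matrix_vector_mult_add_rdistrib scaleR_matrix_vector_assoc[symmetric]
        matrix_vector_mul_assoc[symmetric] saddle_jacobian_mult[OF C2])
  have K: "K *v h = - (Lambda_matrix \<tau> *v flip (hessian f z *v h))" for h
    by (simp add: K_def matrix_vector_mul_assoc[symmetric] H_matrix_mult[OF C2]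
        linear_neg[OF matrix_vector_mul_linear])
  have dw: "(w has_derivative (\<lambda>h. - (K *v h))) (at z)"
    unfolding w_def[abs_def] K minus_minus
    by (intro bounded_linear.has_derivative[OF matrix_vector_mul_bounded_linear]
        saddle_field_has_derivative C2)
  have bil: "bounded_bilinear ((*v) :: real^('n + 'm)^('n + 'm) \<Rightarrow> _)"
    unfolding bilinear_conv_bounded_bilinear[symmetric] bilinear_def
    by (auto intro!: linearI simp: matrix_vector_mult_add_rdistrib scaleR_matrix_vector_assoc[symmetric])
  have "isCont (hessian f) z"
    using C2 by (simp add: C2_def continuous_on_eq_continuous_at)
  then have "((\<lambda>x. hessian f x *v w x) has_derivative (\<lambda>h. hessian f z *v (- (K *v h)))) (at z)"
    by (rule has_derivative_bilinear_at_zero[OF bil _ dw]) (simp add: w_def z)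
  moreover have "bounded_linear flip"
    by (simp add: linear_conv_bounded_linear[symmetric] linear_flip)
  ultimately have "(ode_Os f \<tau> s has_derivative (\<lambda>h. - (- (K *v h) +
      (s / 2) *\<^sub>R (Lambda_matrix \<tau> *v flip (hessian f z *v (- (K *v h))))))) (at z)"
    unfolding os
    by (intro has_derivative_minus has_derivative_add dw has_derivative_scaleR_right
        bounded_linear.has_derivative[OF matrix_vector_mul_bounded_linear]
        bounded_linear.has_derivative[of flip])
  moreover have "Lambda_matrix \<tau> *v flip (hessian f z *v (- (K *v h))) = K *v (K *v h)" for h
    using K[of "- (K *v h)"] by (simp add: linear_neg[OF matrix_vector_mul_linear])
  ultimately show ?thesis
    by (elim has_derivative_eq_rhs) (simp add: fun_eq_iff matrix_vector_mult_diff_rdistrib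
        scaleR_matrix_vector_assoc[symmetric] matrix_vector_mul_assoc[symmetric])
qed

theorem theorem4p4:
  fixes f :: "real^('n::finite + 'm::finite) \<Rightarrow> real" and L \<tau> :: real
  assumes "C2 f"
    and "L > 0" and "L-lipschitz_on UNIV (grad f)"
    and "\<forall>z \<in> saddle_points f. invertible (hessian f z)"
    and "\<tau> > 0"
  shows
    "((\<forall>z \<in> saddle_points f. \<forall>\<mu> \<in> spectrum (Lambda_matrix \<tau> ** H_matrix f z). Re \<mu> \<noteq> 0)
        \<longrightarrow> saddle_points f \<subseteq> exp_stable_equilibria (ode_O1 f \<tau>))
     \<and>
     (\<forall>s>0.
        (\<forall>z \<in> saddle_points f.
           (\<forall>\<mu> \<in> spectrum (Lambda_matrix \<tau> ** H_matrix f z). Re \<mu> \<noteq> 0) \<and>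
           s \<in> {0 <..< min (min 1 \<tau> / L)
                   (MIN \<mu> \<in> spectrum (Lambda_matrix \<tau> ** H_matrix f z).
                      2 * \<bar>Re \<mu>\<bar> / max (L ^ 2) (\<tau> powi (-2) * L ^ 2))})
        \<longrightarrow> saddle_points f \<subseteq> exp_stable_equilibria (ode_Os f \<tau> s))"
proof (intro conjI impI allI subsetI)
  note C2 = \<open>C2 f\<close>
  have neg: "Re \<mu> < 0" if "z \<in> saddle_points f" "\<mu> \<in> spectrum (Lambda_matrix \<tau> ** H_matrix f z)" "Re \<mu> \<noteq> 0" for z \<mu>
    using spectrum_Lambda_H_nonpos[OF C2 that(1) \<open>\<tau> > 0\<close> that(2)] that(3) by simp
  {
    fix z
    assume "\<forall>z \<in> saddle_points f. \<forall>\<mu> \<in> spectrum (Lambda_matrix \<tau> ** H_matrix f z). Re \<mu> \<noteq> 0"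
      and z: "z \<in> saddle_points f"
    then show "z \<in> exp_stable_equilibria (ode_O1 f \<tau>)"
      by (intro linearization_exp_stable[OF _ ode_O1_has_derivative[OF C2]])
        (auto simp: ode_O1_def saddle_field_zero[OF C2 z] neg)
  next
    fix s :: real and z
    let ?K = "Lambda_matrix \<tau> ** H_matrix f z" and ?m = "max (L ^ 2) (\<tau> powi (-2) * L ^ 2)"
    assume "0 < s" and hyp: "\<forall>z \<in> saddle_points f.
           (\<forall>\<mu> \<in> spectrum (Lambda_matrix \<tau> ** H_matrix f z). Re \<mu> \<noteq> 0) \<and>
           s \<in> {0 <..< min (min 1 \<tau> / L)
                   (MIN \<mu> \<in> spectrum (Lambda_matrix \<tau> ** H_matrix f z).
                      2 * \<bar>Re \<mu>\<bar> / max (L ^ 2) (\<tau> powi (-2) * L ^ 2))}"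
      and z: "z \<in> saddle_points f"
    have small: "s < 2 * \<bar>Re \<mu>\<bar> / ?m" if "\<mu> \<in> spectrum ?K" for \<mu>
    proof -
      have "s < (MIN \<mu> \<in> spectrum ?K. 2 * \<bar>Re \<mu>\<bar> / ?m)"
        using hyp z by auto
      also have "\<dots> \<le> 2 * \<bar>Re \<mu>\<bar> / ?m"
        by (rule Min_le) (use finite_spectrum that in auto)
      finally show ?thesis .
    qed
    have "Re \<nu> < 0" if \<nu>: "\<nu> \<in> spectrum (?K - (s / 2) *\<^sub>R (?K ** ?K))" for \<nu>
    proof -
      \<comment> \<open>For this eigenvalue of K the bound on |\<mu>|^2 and the condition on s
        combine to s |\<mu>|^2 < 2 |Re \<mu>|.\<close>
      obtain \<mu> where \<mu>: "\<mu> \<in> spectrum ?K" "\<nu> = \<mu> - of_real (s / 2) * \<mu>\<^sup>2"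
        by (rule spectrum_quadratic[OF \<nu>]) (use \<open>0 < s\<close> in auto)
      have "Re \<mu> < 0"
        using neg[OF z \<mu>(1)] hyp z \<mu>(1) by blast
      moreover have "?m > 0"
        using \<open>L > 0\<close> by (simp add: less_max_iff_disj)
      ultimately show ?thesis
        unfolding \<mu>(2)
        by (intro Re_quadratic_neg[OF _ \<open>0 < s\<close> spectrum_Lambda_H_bound[OF C2 assms(3) \<open>\<tau> > 0\<close> \<mu>(1)] _ small[OF \<mu>(1)]])
    qed
    then show "z \<in> exp_stable_equilibria (ode_Os f \<tau> s)"
      by (intro linearization_exp_stable[OF _ ode_Os_has_derivative[OF C2 saddle_field_zero[OF C2 z]]])
        (auto simp: ode_Os_def saddle_field_zero[OF C2 z])
  }
qed

end
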